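(* Let $\lambda>0$. Any solution $U:\mathbf{V}\to\mathbb{R}$ of the discrete equation $$U(x)=\min_{e\in\mathbf{E},\ \mathrm{t}(e)=x}\rho\big(U(\mathrm{o}(e)),e\big)\qquad\text{for all }x\in\mathbf{V}$$ can be uniquely extended to a solution $u:\Gamma\to\mathbb{R}$ of the discounted Hamilton--Jacobi problem on the network $\Gamma$ (i.e. there is exactly one solution $u$ on $\Gamma$ with $u|_{\mathbf{V}}=U$). Conversely, given a solution $u$ of the discounted Hamilton--Jacobi problem on $\Gamma$, the restriction $U=u|_{\mathbf{V}}$ is a solution of the discrete equation.
   Context: Network: $\Gamma=\bigcup_{\gamma\in\mathcal{E}}\gamma([0,1])\subset\mathbb{R}^N$, where $\mathcal{E}$ is a finite collection of regular simple curves $\gamma:[0,1]\to\mathbb{R}^N$ (arcs; closed arcs with $\gamma(0)=\gamma(1)$, and several arcs joining the same points, are allowed). For each arc $\gamma$ the inverse arc $-\gamma$, $(-\gamma)(s)=\gamma(1-s)$, also belongs to $\mathcal{E}$ and is regarded as distinct from $\gamma$; and $\gamma((0,1))\cap\gamma'([0,1])=\emptyset$ whenever $\gamma\ne\pm\gamma'$. $\mathbf{V}$ is the (finite) set of vertices, i.e. of initial and terminal points of arcs. $\Gamma$ is connected: any two vertices are linked by a finite concatenation of arcs. Hamiltonians: for each $\gamma\in\mathcal{E}$, $H_\gamma:[0,1]\times\mathbb{R}\to\mathbb{R}$ is continuous in $(s,p)$, coercive in $p$ ($H_\gamma(s,p)\to+\infty$ as $|p|\to\infty$, uniformly in $s$),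 and $H_{-\gamma}(s,p)=H_\gamma(1-s,-p)$. No convexity is assumed. Equation on an arc: (E$_\gamma$) $\lambda w+H_\gamma(s,w')=0$ in $(0,1)$; sub/super/solutions are continuous functions on $[0,1]$ satisfying it in the viscosity sense in $(0,1)$. A continuous $w$ on $[0,1]$ satisfies the state constraint boundary condition for (E$_\gamma$) at $s=1$ if $\lambda\varphi(1)+H_\gamma(1,\varphi'(1))\ge 0$ for every $C^1$ function $\varphi$ with $\varphi(1)=w(1)$ and $w\ge\varphi$ in $(1-\delta,1)$ for some $\delta>0$. Problem on $\Gamma$: a subsolution is a continuous $u:\Gamma\to\mathbb{R}$ such that $u\circ\gamma$ is a subsolution of (E$_\gamma$) for every $\gamma\in\mathcal{E}$. A supersolution is a continuous $u:\Gamma\to\mathbb{R}$ such that $u\circ\gamma$ is a supersolution of (E$_\gamma$) for every $\gamma\in\mathcal{E}$ and, for every vertex $x$, there is at least one arc $\gamma$ with $\gamma(1)=x$ such that $u\circ\gamma$ satisfies the state constraint boundary condition for (E$_\gamma$) at $s=1$. A solution is both a subsolution and a supersolution. Graph: $\mathbf{E}$ is an abstract set with a bijection $\Psi:\mathbf{E}\to\mathcal{E}$; for $e\in\mathbf{E}$ put $\mathrm{o}(e)=\Psi(e)(0)$, $-e=\Psi^{-1}(-\Psi(e))$, $\mathrm{t}(e)=\mathrm{o}(-e)=\Psi(e)(1)$. For $\alpha\in\mathbb{R}$ and $\gamma\in\mathcal{E}$ let $u_\alpha^\gamma(s)=\sup\{w(s): w$ subsolution of (E$_\gamma$) with $w(0)\le\alpha\}$,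 $s\in[0,1]$, and set $\rho(\alpha,e)=u_\alpha^{\Psi(e)}(1)$. *)

theory Defs
  imports "HOL-Analysis.Analysis"
begin

section \<open>Networks\<close>

text \<open>Curves are functions on the closed unit interval. They are represented as elements of
  \<^term>\<open>extensional {0..1}\<close>, so that equality of curves is equality on the unit interval.\<close>

type_synonym 'n curve = "real \<Rightarrow> real ^ 'n"

text \<open>A continuously differentiable curve with nonvanishing velocity; derivatives at the end
  points are one-sided, and no matching is required at the base point of a closed curve.\<close>

definition regular_curve :: "'n::finite curve \<Rightarrow> bool" where
  "regular_curve \<gamma> \<longleftrightarrow>
    (\<exists>\<gamma>'. continuous_on {0..1} \<gamma>' \<and>
      (\<forall>s\<in>{0..1}. (\<gamma> has_vector_derivative \<gamma>' s) (at s within {0..1}) \<and> \<gamma>' s \<noteq> 0))"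

definition inverse_arc :: "'n::finite curve \<Rightarrow> 'n curve" where
  "inverse_arc \<gamma> = restrict (reversepath \<gamma>) {0..1}"

definition network_vertices :: "'n::finite curve set \<Rightarrow> (real ^ 'n) set" where
  "network_vertices A = (\<Union>\<gamma>\<in>A. {\<gamma> 0, \<gamma> 1})"

definition network_set :: "'n::finite curve set \<Rightarrow> (real ^ 'n) set" where
  "network_set A = (\<Union>\<gamma>\<in>A. path_image \<gamma>)"

text \<open>That an arc differs from its inverse needs no separate requirement: it follows from
  \<^const>\<open>simple_path\<close>. In the last clause, the transitive closure of the relation ``some arc
  leads from one point to the other'' expresses finite concatenations of arcs.\<close>

definition network :: "'n::finite curve set \<Rightarrow> bool" where
  "network A \<longleftrightarrow>
    finite A \<and> A \<subseteq> extensional {0..1} \<and>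
    (\<forall>\<gamma>\<in>A. simple_path \<gamma> \<and> regular_curve \<gamma>) \<and>
    (\<forall>\<gamma>\<in>A. inverse_arc \<gamma> \<in> A) \<and>
    (\<forall>\<gamma>\<in>A. \<forall>\<gamma>'\<in>A. \<gamma> \<noteq> \<gamma>' \<and> \<gamma> \<noteq> inverse_arc \<gamma>' \<longrightarrow> \<gamma> ` {0<..<1} \<inter> path_image \<gamma>' = {}) \<and>
    (\<forall>x\<in>network_vertices A. \<forall>y\<in>network_vertices A. (x, y) \<in> {(\<gamma> 0, \<gamma> 1) | \<gamma>. \<gamma> \<in> A}\<^sup>+)"

section \<open>Hamiltonians\<close>

definition coercive_hamiltonian :: "(real \<Rightarrow> real \<Rightarrow> real) \<Rightarrow> bool" where
  "coercive_hamiltonian h \<longleftrightarrow> (\<forall>M. \<forall>\<^sub>F p in at_infinity. \<forall>s\<in>{0..1}. M \<le> h s p)"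

definition network_hamiltonian ::
    "'n::finite curve set \<Rightarrow> ('n curve \<Rightarrow> real \<Rightarrow> real \<Rightarrow> real) \<Rightarrow> bool" where
  "network_hamiltonian A H \<longleftrightarrow>
    (\<forall>\<gamma>\<in>A. continuous_on ({0..1} \<times> UNIV) (\<lambda>(s, p). H \<gamma> s p) \<and>
      coercive_hamiltonian (H \<gamma>) \<and>
      (\<forall>s\<in>{0..1}. \<forall>p. H (inverse_arc \<gamma>) s p = H \<gamma> (1 - s) (- p)))"

section \<open>Viscosity solutions on the unit interval\<close>

text \<open>The equation on an arc is \<open>lam * w + h s w' = 0\<close> in the open unit interval. Test
  functions are continuously differentiable on the whole real line; only their local behaviour
  at the contact point matters.\<close>

definition arc_subsolution :: "real \<Rightarrow> (real \<Rightarrow> real \<Rightarrow> real) \<Rightarrow> (real \<Rightarrow> real) \<Rightarrow> bool" where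
  "arc_subsolution lam h w \<longleftrightarrow> continuous_on {0..1} w \<and>
    (\<forall>s\<in>{0<..<1}. \<forall>\<phi>. \<phi> C1_differentiable_on UNIV \<longrightarrow>
      (\<forall>\<^sub>F r in at s. w r - \<phi> r \<le> w s - \<phi> s) \<longrightarrow>
      lam * w s + h s (deriv \<phi> s) \<le> 0)"

definition arc_supersolution :: "real \<Rightarrow> (real \<Rightarrow> real \<Rightarrow> real) \<Rightarrow> (real \<Rightarrow> real) \<Rightarrow> bool" where
  "arc_supersolution lam h w \<longleftrightarrow> continuous_on {0..1} w \<and>
    (\<forall>s\<in>{0<..<1}. \<forall>\<phi>. \<phi> C1_differentiable_on UNIV \<longrightarrow>
      (\<forall>\<^sub>F r in at s. w r - \<phi> r \<ge> w s - \<phi> s) \<longrightarrow>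
      lam * w s + h s (deriv \<phi> s) \<ge> 0)"

definition state_constraint :: "real \<Rightarrow> (real \<Rightarrow> real \<Rightarrow> real) \<Rightarrow> (real \<Rightarrow> real) \<Rightarrow> bool" where
  "state_constraint lam h w \<longleftrightarrow>
    (\<forall>\<phi>. \<phi> C1_differentiable_on UNIV \<longrightarrow> \<phi> 1 = w 1 \<longrightarrow>
      (\<exists>\<delta>>0. \<forall>r\<in>{1 - \<delta><..<1}. w r \<ge> \<phi> r) \<longrightarrow>
      lam * \<phi> 1 + h 1 (deriv \<phi> 1) \<ge> 0)"

section \<open>The problem on the network\<close>

definition network_subsolution ::
    "'n::finite curve set \<Rightarrow> real \<Rightarrow> ('n curve \<Rightarrow> real \<Rightarrow> real \<Rightarrow> real) \<Rightarrow> (real ^ 'n \<Rightarrow> real) \<Rightarrow> bool"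
  where
  "network_subsolution A lam H u \<longleftrightarrow> continuous_on (network_set A) u \<and>
    (\<forall>\<gamma>\<in>A. arc_subsolution lam (H \<gamma>) (u \<circ> \<gamma>))"

definition network_supersolution ::
    "'n::finite curve set \<Rightarrow> real \<Rightarrow> ('n curve \<Rightarrow> real \<Rightarrow> real \<Rightarrow> real) \<Rightarrow> (real ^ 'n \<Rightarrow> real) \<Rightarrow> bool"
  where
  "network_supersolution A lam H u \<longleftrightarrow> continuous_on (network_set A) u \<and>
    (\<forall>\<gamma>\<in>A. arc_supersolution lam (H \<gamma>) (u \<circ> \<gamma>)) \<and>
    (\<forall>x\<in>network_vertices A. \<exists>\<gamma>\<in>A. \<gamma> 1 = x \<and> state_constraint lam (H \<gamma>) (u \<circ> \<gamma>))"

definition network_solution ::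
    "'n::finite curve set \<Rightarrow> real \<Rightarrow> ('n curve \<Rightarrow> real \<Rightarrow> real \<Rightarrow> real) \<Rightarrow> (real ^ 'n \<Rightarrow> real) \<Rightarrow> bool"
  where
  "network_solution A lam H u \<longleftrightarrow> network_subsolution A lam H u \<and> network_supersolution A lam H u"

section \<open>The underlying graph and the discrete equation\<close>

definition edge_origin :: "('e \<Rightarrow> 'n::finite curve) \<Rightarrow> 'e \<Rightarrow> real ^ 'n" where
  "edge_origin \<Psi> e = \<Psi> e 0"

definition edge_inverse :: "'e set \<Rightarrow> ('e \<Rightarrow> 'n::finite curve) \<Rightarrow> 'e \<Rightarrow> 'e" where
  "edge_inverse E \<Psi> e = inv_into E \<Psi> (inverse_arc (\<Psi> e))"

definition edge_terminal :: "'e set \<Rightarrow> ('e \<Rightarrow> 'n::finite curve) \<Rightarrow> 'e \<Rightarrow> real ^ 'n" where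
  "edge_terminal E \<Psi> e = edge_origin \<Psi> (edge_inverse E \<Psi> e)"

lemma edge_terminal_eq:
  assumes "network A" "bij_betw \<Psi> E A" "e \<in> E"
  shows "edge_terminal E \<Psi> e = \<Psi> e 1"
proof -
  have "inverse_arc (\<Psi> e) \<in> \<Psi> ` E"
    using assms by (auto simp: network_def bij_betw_def)
  then show ?thesis
    by (simp add: edge_terminal_def edge_origin_def edge_inverse_def f_inv_into_f
        inverse_arc_def reversepath_def)
qed

text \<open>The supremum is over a nonempty set bounded above when \<open>lam > 0\<close> and \<open>h\<close> is continuous
  and coercive: constant functions close to minus infinity are subsolutions, and subsolutions
  are bounded above by \<open>- inf h / lam\<close>.\<close>

definition maximal_subsolution ::
    "real \<Rightarrow> (real \<Rightarrow> real \<Rightarrow> real) \<Rightarrow> real \<Rightarrow> real \<Rightarrow> real" where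
  "maximal_subsolution lam h \<alpha> s = Sup {w s | w. arc_subsolution lam h w \<and> w 0 \<le> \<alpha>}"

definition edge_rho ::
    "('e \<Rightarrow> 'n::finite curve) \<Rightarrow> real \<Rightarrow> ('n curve \<Rightarrow> real \<Rightarrow> real \<Rightarrow> real) \<Rightarrow> real \<Rightarrow> 'e \<Rightarrow> real" where
  "edge_rho \<Psi> lam H \<alpha> e = maximal_subsolution lam (H (\<Psi> e)) \<alpha> 1"

definition discrete_solution ::
    "'n::finite curve set \<Rightarrow> 'e set \<Rightarrow> ('e \<Rightarrow> 'n curve) \<Rightarrow> real \<Rightarrow>
      ('n curve \<Rightarrow> real \<Rightarrow> real \<Rightarrow> real) \<Rightarrow> (real ^ 'n \<Rightarrow> real) \<Rightarrow> bool" where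
  "discrete_solution A E \<Psi> lam H U \<longleftrightarrow>
    (\<forall>x\<in>network_vertices A.
      U x = Min {edge_rho \<Psi> lam H (U (edge_origin \<Psi> e)) e | e. e \<in> E \<and> edge_terminal E \<Psi> e = x})"

end

theory Submission
  imports Defs
begin

text \<open>
  On a single arc everything rests on one comparison principle (\<open>comparison\<close>): a subsolution lies below
  a supersolution if it does so at \<open>0\<close> and if, at \<open>1\<close>, either the same holds or the supersolution
  satisfies the state constraint. It is proved by doubling variables with a shift of the penalty that keeps
  the subsolution's contact point away from \<open>1\<close>. Coercivity makes
  subsolutions Lipschitz and confines the momenta at contact points to a compact set.

  Perron's method applied to the subsolutions with upper bounds \<open>\<alpha>\<close> at \<open>0\<close> and \<open>\<beta>\<close> at \<open>1\<close>
  yields a solution on the open interval. If the bound \<open>\<beta>\<close> is not active, the supremum also satisfies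
  the state constraint at \<open>1\<close>; this is the case of the maximal subsolution, whose value at \<open>1\<close> is
  \<open>\<rho>(\<alpha>, e)\<close>.

  A solution \<open>u\<close> on the network is a subsolution on each arc, which gives \<open>u(\<gamma>(1)) \<le> \<rho>(u(\<gamma>(0)), \<gamma>)\<close>.
  On an arc where it satisfies the state constraint, comparison with the maximal subsolution gives the
  reverse inequality (\<open>state_constraint_imp_maximal\<close>). Since every vertex is the terminal point of such an
  arc, the minimum in the discrete equation is attained.

  Conversely, let \<open>U\<close> solve the discrete equation. Its inequality on \<open>\<gamma>\<close> and on \<open>- \<gamma>\<close> provides one subsolution on \<open>\<gamma>\<close>
  that starts at most at \<open>U(\<gamma>(0))\<close> and ends at least at \<open>U(\<gamma>(1))\<close>, and another one with both inequalities
  reversed. Subsolutions may be lowered by constants because \<open>lam > 0\<close>, so the Perron supremum attains both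
  end point values (\<open>dirichlet_solvable\<close>). These Dirichlet solutions are unique by comparison, hence
  compatible with reversal of arcs, and they glue to a continuous function on the network
  (\<open>glue_arc_functions\<close>). On an arc attaining the minimum, the Dirichlet solution is the maximal subsolution
  and inherits its state constraint. Uniqueness of the extension is again uniqueness of the Dirichlet
  problem on each arc.
\<close>

section \<open>Test functions\<close>

lemma C1_iff_real_derivative:
  fixes \<phi> :: "real \<Rightarrow> real"
  shows "\<phi> C1_differentiable_on UNIV \<longleftrightarrow>
    (\<forall>r. (\<phi> has_real_derivative deriv \<phi> r) (at r)) \<and> continuous_on UNIV (deriv \<phi>)"
proof
  assume "\<phi> C1_differentiable_on UNIV"
  then obtain D where D: "\<And>r. (\<phi> has_real_derivative D r) (at r)" "continuous_on UNIV D"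
    unfolding C1_differentiable_on_def has_real_derivative_iff_has_vector_derivative by auto
  then have "deriv \<phi> = D"
    by (auto intro: DERIV_imp_deriv)
  with D show "(\<forall>r. (\<phi> has_real_derivative deriv \<phi> r) (at r)) \<and> continuous_on UNIV (deriv \<phi>)"
    by simp
next
  assume "(\<forall>r. (\<phi> has_real_derivative deriv \<phi> r) (at r)) \<and> continuous_on UNIV (deriv \<phi>)"
  then show "\<phi> C1_differentiable_on UNIV"
    unfolding C1_differentiable_on_def has_real_derivative_iff_has_vector_derivative by auto
qed

lemma C1I:
  fixes \<phi> :: "real \<Rightarrow> real"
  assumes "\<And>r. (\<phi> has_real_derivative D r) (at r)" "continuous_on UNIV D"
  shows "\<phi> C1_differentiable_on UNIV" and "deriv \<phi> = D"
proof -
  show "deriv \<phi> = D"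
    using assms(1) by (auto intro: DERIV_imp_deriv)
  then show "\<phi> C1_differentiable_on UNIV"
    using assms by (simp add: C1_iff_real_derivative)
qed

lemma eventually_at_openI:
  fixes s :: real
  assumes "a < s" "s < b" "\<And>r. r \<in> {a<..<b} \<Longrightarrow> P r"
  shows "eventually P (at s)"
  using assms by (intro eventually_at_in_open'[THEN eventually_mono, of "{a<..<b}"]) auto

lemma arc_subsolutionD:
  assumes "arc_subsolution lam h w" "0 \<le> a" "b \<le> 1" "s \<in> {a<..<b}"
    and "\<And>r. (\<phi> has_real_derivative D r) (at r)" "continuous_on UNIV D"
    and "\<And>r. r \<in> {a<..<b} \<Longrightarrow> w r - \<phi> r \<le> w s - \<phi> s"
  shows "lam * w s + h s (D s) \<le> 0"
proof -
  have "eventually (\<lambda>r. w r - \<phi> r \<le> w s - \<phi> s) (at s)"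
    by (rule eventually_at_openI[of a s b]) (use assms in auto)
  moreover have "s \<in> {0<..<1}"
    using assms(2-4) by auto
  ultimately show ?thesis
    using assms(1) C1I[OF assms(5,6)] unfolding arc_subsolution_def by metis
qed

lemma arc_supersolutionD:
  assumes "arc_supersolution lam h w" "0 \<le> a" "b \<le> 1" "s \<in> {a<..<b}"
    and "\<And>r. (\<phi> has_real_derivative D r) (at r)" "continuous_on UNIV D"
    and "\<And>r. r \<in> {a<..<b} \<Longrightarrow> w r - \<phi> r \<ge> w s - \<phi> s"
  shows "lam * w s + h s (D s) \<ge> 0"
proof -
  have "eventually (\<lambda>r. w r - \<phi> r \<ge> w s - \<phi> s) (at s)"
    by (rule eventually_at_openI[of a s b]) (use assms in auto)
  moreover have "s \<in> {0<..<1}"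
    using assms(2-4) by auto
  ultimately show ?thesis
    using assms(1) C1I[OF assms(5,6)] unfolding arc_supersolution_def by metis
qed

lemma state_constraintD:
  assumes "state_constraint lam h w" "a < 1"
    and "\<And>r. (\<phi> has_real_derivative D r) (at r)" "continuous_on UNIV D"
    and "\<And>r. r \<in> {a<..<1} \<Longrightarrow> w r - \<phi> r \<ge> w 1 - \<phi> 1"
  shows "lam * w 1 + h 1 (D 1) \<ge> 0"
proof -
  define \<psi> where "\<psi> r = \<phi> r + (w 1 - \<phi> 1)" for r
  have "(\<psi> has_real_derivative D r) (at r)" for r
    unfolding \<psi>_def using assms(3)[of r] by (auto intro!: derivative_eq_intros)
  note C1 = C1I[OF this assms(4)]
  have "\<exists>\<delta>>0. \<forall>r\<in>{1 - \<delta><..<1}. w r \<ge> \<psi> r"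
    using assms(2,5) by (intro exI[of _ "1 - a"]) (auto simp: \<psi>_def algebra_simps)
  moreover have "\<psi> 1 = w 1"
    by (simp add: \<psi>_def)
  ultimately show ?thesis
    using assms(1) C1 unfolding state_constraint_def by metis
qed

lemma arc_subsolution_cong:
  assumes "arc_subsolution lam h w" "\<And>s. s \<in> {0..1} \<Longrightarrow> w s = w' s"
  shows "arc_subsolution lam h w'"
  unfolding arc_subsolution_def
proof (intro conjI ballI allI impI)
  show "continuous_on {0..1} w'"
    using assms continuous_on_cong[of "{0..1}" "{0..1}" w w'] by (auto simp: arc_subsolution_def)
next
  fix s :: real and \<phi> assume s: "s \<in> {0<..<1}" "\<phi> C1_differentiable_on UNIV"
    "\<forall>\<^sub>F r in at s. w' r - \<phi> r \<le> w' s - \<phi> s"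
  have "\<forall>\<^sub>F r in at s. r \<in> {0<..<1}"
    using s by (intro eventually_at_openI[of 0 s 1]) auto
  with s(3) have "\<forall>\<^sub>F r in at s. w r - \<phi> r \<le> w s - \<phi> s"
    by eventually_elim (use s(1) assms(2) in auto)
  then have "lam * w s + h s (deriv \<phi> s) \<le> 0"
    using assms(1) s(1,2) unfolding arc_subsolution_def by blast
  then show "lam * w' s + h s (deriv \<phi> s) \<le> 0"
    using s(1) assms(2)[of s] by simp
qed

lemma arc_supersolution_cong:
  assumes "arc_supersolution lam h w" "\<And>s. s \<in> {0..1} \<Longrightarrow> w s = w' s"
  shows "arc_supersolution lam h w'"
  unfolding arc_supersolution_def
proof (intro conjI ballI allI impI)
  show "continuous_on {0..1} w'"
    using assms continuous_on_cong[of "{0..1}" "{0..1}" w w'] by (auto simp: arc_supersolution_def)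
next
  fix s :: real and \<phi> assume s: "s \<in> {0<..<1}" "\<phi> C1_differentiable_on UNIV"
    "\<forall>\<^sub>F r in at s. w' r - \<phi> r \<ge> w' s - \<phi> s"
  have "\<forall>\<^sub>F r in at s. r \<in> {0<..<1}"
    using s by (intro eventually_at_openI[of 0 s 1]) auto
  with s(3) have "\<forall>\<^sub>F r in at s. w r - \<phi> r \<ge> w s - \<phi> s"
    by eventually_elim (use s(1) assms(2) in auto)
  then have "lam * w s + h s (deriv \<phi> s) \<ge> 0"
    using assms(1) s(1,2) unfolding arc_supersolution_def by blast
  then show "lam * w' s + h s (deriv \<phi> s) \<ge> 0"
    using s(1) assms(2)[of s] by simp
qed

lemma state_constraint_cong:
  assumes "state_constraint lam h w" "\<And>s. s \<in> {0..1} \<Longrightarrow> w s = w' s"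
  shows "state_constraint lam h w'"
  unfolding state_constraint_def
proof (intro allI impI)
  fix \<phi> assume \<phi>: "\<phi> C1_differentiable_on UNIV" "\<phi> 1 = w' 1"
    "\<exists>\<delta>>0. \<forall>r\<in>{1 - \<delta><..<1}. w' r \<ge> \<phi> r"
  then obtain \<delta> where \<delta>: "\<delta> > 0" "\<forall>r\<in>{1 - \<delta><..<1}. w' r \<ge> \<phi> r"
    by auto
  then have "\<exists>\<delta>>0. \<forall>r\<in>{1 - \<delta><..<1}. w r \<ge> \<phi> r"
    using assms(2) by (intro exI[of _ "min \<delta> 1"]) auto
  moreover have "\<phi> 1 = w 1"
    using \<phi> assms(2) by auto
  ultimately show "lam * \<phi> 1 + h 1 (deriv \<phi> 1) \<ge> 0"
    using assms(1) \<phi>(1) unfolding state_constraint_def by blast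
qed

lemma eventually_at_reflect:
  fixes s :: real
  assumes "\<forall>\<^sub>F r in at s. P r"
  shows "\<forall>\<^sub>F r in at (1 - s). P (1 - r)"
proof -
  from assms obtain d where d: "d > 0" "\<And>r. r \<noteq> s \<Longrightarrow> dist r s < d \<Longrightarrow> P r"
    unfolding eventually_at by auto
  have "P (1 - r)" if "r \<noteq> 1 - s" "dist r (1 - s) < d" for r
    using that by (intro d(2)) (auto simp: dist_real_def)
  then show ?thesis
    using d(1) unfolding eventually_at by auto
qed

lemma C1_reflect:
  fixes \<phi> :: "real \<Rightarrow> real"
  assumes "\<phi> C1_differentiable_on UNIV"
  shows "(\<lambda>r. \<phi> (1 - r)) C1_differentiable_on UNIV"
    and "deriv (\<lambda>r. \<phi> (1 - r)) = (\<lambda>r. - deriv \<phi> (1 - r))"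
proof -
  have \<phi>: "(\<phi> has_real_derivative deriv \<phi> r) (at r)" "continuous_on UNIV (deriv \<phi>)" for r
    using assms by (auto simp: C1_iff_real_derivative)
  have 1: "((\<lambda>r. \<phi> (1 - r)) has_real_derivative - deriv \<phi> (1 - r)) (at r)" for r
  proof -
    have "((\<lambda>r. 1 - r) has_real_derivative - 1) (at r)"
      by (auto intro!: derivative_eq_intros)
    from DERIV_chain2[OF \<phi>(1) this] show ?thesis
      by simp
  qed
  have 2: "continuous_on UNIV (\<lambda>r. - deriv \<phi> (1 - r))"
    by (intro continuous_intros continuous_on_compose2[OF \<phi>(2)]) auto
  show "(\<lambda>r. \<phi> (1 - r)) C1_differentiable_on UNIV"
    "deriv (\<lambda>r. \<phi> (1 - r)) = (\<lambda>r. - deriv \<phi> (1 - r))"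
    using C1I[OF 1 2] by auto
qed

lemma continuous_on_reflect:
  fixes w :: "real \<Rightarrow> real"
  assumes "continuous_on {0..1} w"
  shows "continuous_on {0..1} (\<lambda>s. w (1 - s))"
  by (intro continuous_on_compose2[OF assms] continuous_intros) auto

text \<open>Reflection carries the equation on an arc to the one on the inverse arc, and it turns one-sided
  estimates into two-sided ones.\<close>

lemma arc_subsolution_reflect:
  assumes w: "arc_subsolution lam h w"
    and h': "\<And>s p. s \<in> {0..1} \<Longrightarrow> h' s p = h (1 - s) (- p)"
  shows "arc_subsolution lam h' (\<lambda>s. w (1 - s))"
  unfolding arc_subsolution_def
proof (intro conjI ballI allI impI)
  show "continuous_on {0..1} (\<lambda>s. w (1 - s))"
    using w by (intro continuous_on_reflect) (auto simp: arc_subsolution_def)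
next
  fix s :: real and \<phi> assume s: "s \<in> {0<..<1}" "\<phi> C1_differentiable_on UNIV"
    "\<forall>\<^sub>F r in at s. w (1 - r) - \<phi> r \<le> w (1 - s) - \<phi> s"
  have "\<forall>\<^sub>F r in at (1 - s). w r - \<phi> (1 - r) \<le> w (1 - s) - \<phi> (1 - (1 - s))"
    using eventually_at_reflect[OF s(3)] by simp
  moreover have "1 - s \<in> {0<..<1}"
    using s by auto
  ultimately have "lam * w (1 - s) + h (1 - s) (deriv (\<lambda>r. \<phi> (1 - r)) (1 - s)) \<le> 0"
    using w C1_reflect(1)[OF s(2)] unfolding arc_subsolution_def by blast
  then show "lam * w (1 - s) + h' s (deriv \<phi> s) \<le> 0"
    using s h' C1_reflect(2)[OF s(2)] by simp
qed

lemma arc_supersolution_reflect: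
  assumes w: "arc_supersolution lam h w"
    and h': "\<And>s p. s \<in> {0..1} \<Longrightarrow> h' s p = h (1 - s) (- p)"
  shows "arc_supersolution lam h' (\<lambda>s. w (1 - s))"
  unfolding arc_supersolution_def
proof (intro conjI ballI allI impI)
  show "continuous_on {0..1} (\<lambda>s. w (1 - s))"
    using w by (intro continuous_on_reflect) (auto simp: arc_supersolution_def)
next
  fix s :: real and \<phi> assume s: "s \<in> {0<..<1}" "\<phi> C1_differentiable_on UNIV"
    "\<forall>\<^sub>F r in at s. w (1 - r) - \<phi> r \<ge> w (1 - s) - \<phi> s"
  have "\<forall>\<^sub>F r in at (1 - s). w r - \<phi> (1 - r) \<ge> w (1 - s) - \<phi> (1 - (1 - s))"
    using eventually_at_reflect[OF s(3)] by simp
  moreover have "1 - s \<in> {0<..<1}"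
    using s by auto
  ultimately have "lam * w (1 - s) + h (1 - s) (deriv (\<lambda>r. \<phi> (1 - r)) (1 - s)) \<ge> 0"
    using w C1_reflect(1)[OF s(2)] unfolding arc_supersolution_def by blast
  then show "lam * w (1 - s) + h' s (deriv \<phi> s) \<ge> 0"
    using s h' C1_reflect(2)[OF s(2)] by simp
qed

lemma arc_subsolution_max:
  assumes "arc_subsolution lam h v" "arc_subsolution lam h w"
  shows "arc_subsolution lam h (\<lambda>s. max (v s) (w s))"
  unfolding arc_subsolution_def
proof (intro conjI ballI allI impI)
  show "continuous_on {0..1} (\<lambda>s. max (v s) (w s))"
    using assms by (auto simp: arc_subsolution_def intro!: continuous_intros)
next
  fix s :: real and \<phi> assume s: "s \<in> {0<..<1}" "\<phi> C1_differentiable_on UNIV"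
    "\<forall>\<^sub>F r in at s. max (v r) (w r) - \<phi> r \<le> max (v s) (w s) - \<phi> s"
  show "lam * max (v s) (w s) + h s (deriv \<phi> s) \<le> 0"
  proof (cases "v s \<ge> w s")
    case True
    then have "\<forall>\<^sub>F r in at s. v r - \<phi> r \<le> v s - \<phi> s"
      using s(3) by (auto elim!: eventually_mono)
    then show ?thesis
      using assms(1) s True unfolding arc_subsolution_def by (auto simp: max_def)
  next
    case False
    then have "\<forall>\<^sub>F r in at s. w r - \<phi> r \<le> w s - \<phi> s"
      using s(3) by (auto elim!: eventually_mono)
    then show ?thesis
      using assms(2) s False unfolding arc_subsolution_def by (auto simp: max_def)
  qed
qed

text \<open>For \<open>lam > 0\<close> the left-hand side of the equation increases with the unknown.\<close>

lemma arc_subsolution_shift: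
  assumes "arc_subsolution lam h w" "lam > 0" "c \<ge> 0"
  shows "arc_subsolution lam h (\<lambda>s. w s - c)"
  unfolding arc_subsolution_def
proof (intro conjI ballI allI impI)
  show "continuous_on {0..1} (\<lambda>s. w s - c)"
    using assms by (auto simp: arc_subsolution_def intro!: continuous_intros)
next
  fix s :: real and \<phi> assume s: "s \<in> {0<..<1}" "\<phi> C1_differentiable_on UNIV"
    "\<forall>\<^sub>F r in at s. w r - c - \<phi> r \<le> w s - c - \<phi> s"
  then have "\<forall>\<^sub>F r in at s. w r - \<phi> r \<le> w s - \<phi> s"
    by (auto elim!: eventually_mono)
  then have "lam * w s + h s (deriv \<phi> s) \<le> 0"
    using assms s unfolding arc_subsolution_def by blast
  moreover have "lam * (w s - c) \<le> lam * w s"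
    using assms by simp
  ultimately show "lam * (w s - c) + h s (deriv \<phi> s) \<le> 0"
    by linarith
qed

section \<open>Bounds on subsolutions\<close>

locale arc_hamiltonian =
  fixes lam :: real and h :: "real \<Rightarrow> real \<Rightarrow> real"
  assumes lam_pos: "lam > 0"
    and h_cont: "continuous_on ({0..1} \<times> UNIV) (\<lambda>(s, p). h s p)"
    and h_coercive: "coercive_hamiltonian h"
begin

lemma coercive_bound:
  obtains P where "P > 0" "\<And>s p. s \<in> {0..1} \<Longrightarrow> \<bar>p\<bar> \<ge> P \<Longrightarrow> C < h s p"
proof -
  obtain b where b: "\<And>p. norm p \<ge> b \<Longrightarrow> \<forall>s\<in>{0..1}. C + 1 \<le> h s p"
    using h_coercive unfolding coercive_hamiltonian_def eventually_at_infinity by meson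
  show thesis
  proof (rule that[of "max b 1"])
    fix s p :: real assume "s \<in> {0..1}" "\<bar>p\<bar> \<ge> max b 1"
    then show "C < h s p"
      using b[of p] by fastforce
  qed auto
qed

lemma h_bounded_below:
  obtains m where "\<And>s p. s \<in> {0..1} \<Longrightarrow> m \<le> h s p"
proof -
  obtain P where P: "P > 0" "\<And>s p. s \<in> {0..1} \<Longrightarrow> \<bar>p\<bar> \<ge> P \<Longrightarrow> 0 < h s p"
    using coercive_bound[of 0] by blast
  have "compact ({0..1::real} \<times> {-P..P})"
    by (intro compact_Times compact_Icc)
  moreover have "continuous_on ({0..1} \<times> {-P..P}) (\<lambda>(s, p). h s p)"
    using h_cont by (rule continuous_on_subset) auto
  ultimately have "bdd_below ((\<lambda>(s, p). h s p) ` ({0..1} \<times> {-P..P}))"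
    by (meson compact_continuous_image compact_imp_bounded bounded_imp_bdd_below)
  then obtain m where m: "\<And>s p. s \<in> {0..1} \<Longrightarrow> p \<in> {-P..P} \<Longrightarrow> m \<le> h s p"
    unfolding bdd_below_def by fastforce
  show thesis
  proof (rule that[of "min m 0"])
    fix s p :: real assume s: "s \<in> {0..1}"
    show "min m 0 \<le> h s p"
    proof (cases "\<bar>p\<bar> \<ge> P")
      case True
      with P(2)[OF s] show ?thesis
        by fastforce
    next
      case False
      then have "p \<in> {-P..P}"
        by auto
      with m[OF s] show ?thesis
        by fastforce
    qed
  qed
qed

lemma constant_subsolutions:
  obtains c0 where "\<And>c. c \<le> c0 \<Longrightarrow> arc_subsolution lam h (\<lambda>_. c)"
proof -
  have "continuous_on {0..1} (\<lambda>s. h s 0)"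
    using continuous_on_compose2[OF h_cont, of "{0..1}" "\<lambda>s. (s, 0)"]
    by (simp add: continuous_on_Pair image_subset_iff)
  then have "bdd_above ((\<lambda>s. h s 0) ` {0..1})"
    by (meson compact_Icc compact_continuous_image compact_imp_bounded bounded_imp_bdd_above)
  then obtain M where M: "\<And>s. s \<in> {0..1} \<Longrightarrow> h s 0 \<le> M"
    unfolding bdd_above_def by fastforce
  show thesis
  proof (rule that[of "- M / lam"])
    fix c assume c: "c \<le> - M / lam"
    then have c: "lam * c \<le> - M"
      using lam_pos by (simp add: field_simps)
    show "arc_subsolution lam h (\<lambda>_. c)"
      unfolding arc_subsolution_def
    proof (intro conjI ballI allI impI)
      fix s :: real and \<phi> :: "real \<Rightarrow> real" assume s: "s \<in> {0<..<1}" "\<phi> C1_differentiable_on UNIV"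
        "\<forall>\<^sub>F r in at s. c - \<phi> r \<le> c - \<phi> s"
      obtain d where d: "d > 0" "\<And>r. r \<noteq> s \<Longrightarrow> dist r s < d \<Longrightarrow> \<phi> s \<le> \<phi> r"
        using s(3) unfolding eventually_at by auto
      have "deriv \<phi> s = 0"
      proof (rule DERIV_local_min)
        show "(\<phi> has_real_derivative deriv \<phi> s) (at s)"
          using s(2) by (simp add: C1_iff_real_derivative)
        show "\<forall>y. \<bar>s - y\<bar> < d \<longrightarrow> \<phi> s \<le> \<phi> y"
          using d(2) by (metis abs_minus_commute dist_real_def order_refl)
      qed (rule d)
      then show "lam * c + h s (deriv \<phi> s) \<le> 0"
        using M[of s] s c by auto
    qed auto
  qed
qed

text \<open>A steep downward parabola at an interior point \<open>s\<close> forces a contact point near \<open>s\<close> where the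
  subsolution is at least as large as at \<open>s\<close>; the end points follow by continuity.\<close>

lemma subsolutions_bounded_above:
  obtains M where "\<And>w s. arc_subsolution lam h w \<Longrightarrow> s \<in> {0..1} \<Longrightarrow> w s \<le> M"
proof -
  obtain m where m: "\<And>s p. s \<in> {0..1} \<Longrightarrow> m \<le> h s p"
    using h_bounded_below by blast
  show thesis
  proof (rule that[of "- m / lam"])
    fix w and s0 :: real assume w: "arc_subsolution lam h w" and s0: "s0 \<in> {0..1}"
    have w_cont: "continuous_on {0..1} w"
      using w by (simp add: arc_subsolution_def)
    have interior: "w s \<le> - m / lam" if s: "s \<in> {0<..<1}" for s
    proof -
      define \<delta> where "\<delta> = min s (1 - s)"
      have \<delta>: "\<delta> > 0" "s - \<delta> \<ge> 0" "s + \<delta> \<le> 1"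
        using s by (auto simp: \<delta>_def)
      define K where "K = (\<bar>w (s - \<delta>)\<bar> + \<bar>w (s + \<delta>)\<bar> + \<bar>w s\<bar> + 1) / \<delta>\<^sup>2"
      have K\<delta>: "K * \<delta>\<^sup>2 = \<bar>w (s - \<delta>)\<bar> + \<bar>w (s + \<delta>)\<bar> + \<bar>w s\<bar> + 1"
        using \<delta> by (simp add: K_def)
      have K: "K \<ge> 0"
        by (simp add: K_def)
      define \<phi> where "\<phi> r = K * (r - s)\<^sup>2" for r
      have "continuous_on {s - \<delta>..s + \<delta>} (\<lambda>r. w r - \<phi> r)"
        unfolding \<phi>_def using \<delta>
        by (intro continuous_intros continuous_on_subset[OF w_cont]) auto
      then obtain r where r: "r \<in> {s - \<delta>..s + \<delta>}"
          "\<And>y. y \<in> {s - \<delta>..s + \<delta>} \<Longrightarrow> w y - \<phi> y \<le> w r - \<phi> r"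
        using continuous_attains_sup[of "{s - \<delta>..s + \<delta>}" "\<lambda>r. w r - \<phi> r"] \<delta> by fastforce
      have wr: "w s \<le> w r - \<phi> r"
        using r(2)[of s] \<delta> by (simp add: \<phi>_def)
      have "r \<noteq> s - \<delta>" "r \<noteq> s + \<delta>"
        using wr K\<delta> by (auto simp: \<phi>_def)
      then have rin: "r \<in> {s - \<delta><..<s + \<delta>}"
        using r(1) by auto
      have "lam * w r + h r (2 * K * (r - s)) \<le> 0"
      proof (rule arc_subsolutionD[OF w \<delta>(2,3) rin])
        show "(\<phi> has_real_derivative 2 * K * (r - s)) (at r)" for r
          unfolding \<phi>_def by (auto intro!: derivative_eq_intros)
        show "continuous_on UNIV (\<lambda>r. 2 * K * (r - s))"
          by (intro continuous_intros)
      qed (use r(2) in auto)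
      moreover have "r \<in> {0..1}"
        using r(1) \<delta> by auto
      ultimately have "lam * w r \<le> - m"
        using m[of r "2 * K * (r - s)"] by auto
      then have "w r \<le> - m / lam"
        using lam_pos by (simp add: field_simps)
      moreover have "\<phi> r \<ge> 0"
        using K by (simp add: \<phi>_def)
      ultimately show ?thesis
        using wr by linarith
    qed
    have "w s0 \<le> - m / lam" if "s0 \<in> closure {0<..<1::real}" for s0
    proof (rule continuous_le_on_closure[of "{0<..<1}" w, OF _ that])
      show "continuous_on (closure {0<..<1}) w"
        using w_cont by simp
    qed (use interior in auto)
    then show "w s0 \<le> - m / lam"
      using s0 by simp
  qed
qed

text \<open>If the estimate fails, \<open>w r - L * r\<close> is larger at \<open>b\<close> than at \<open>a\<close>. A rising exponential that is steep
  enough to be negligible up to a point \<open>m\<close> where this function has already grown, but exceeds the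
  whole growth at \<open>b\<close>, then touches it from above at an interior point.\<close>

lemma touching_slopes_imp_one_sided_lipschitz:
  fixes w :: "real \<Rightarrow> real"
  assumes w: "continuous_on {0..1} w"
    and slope: "\<And>\<phi> D s. (\<And>r. (\<phi> has_real_derivative D r) (at r)) \<Longrightarrow> continuous_on UNIV D \<Longrightarrow>
       s \<in> {0<..<1} \<Longrightarrow> (\<forall>\<^sub>F r in at s. w r - \<phi> r \<le> w s - \<phi> s) \<Longrightarrow> D s < L"
    and ab: "0 \<le> a" "a \<le> b" "b \<le> 1"
  shows "w b - w a \<le> L * (b - a)"
proof (rule ccontr)
  assume neg: "\<not> w b - w a \<le> L * (b - a)"
  define g where "g r = w r - L * r" for r
  have gab: "g a < g b"
    using neg by (simp add: g_def algebra_simps)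
  then have "a < b"
    using ab by (cases "a = b") auto
  have g_cont: "continuous_on {a..b} g"
    unfolding g_def using ab by (intro continuous_intros continuous_on_subset[OF w]) auto
  obtain m where m: "a < m" "m < b" "g a < g m"
  proof -
    obtain m where m: "a \<le> m" "m \<le> b" "g m = (g a + g b) / 2"
      using IVT'[of g a "(g a + g b) / 2" b] gab \<open>a < b\<close> g_cont by auto
    then have "m \<noteq> a" "m \<noteq> b"
      using gab by auto
    with m gab show thesis
      by (intro that[of m]) auto
  qed
  define C where "C = g b - g a + 1"
  have "C > 0" using gab by (simp add: C_def)
  define K where "K = (\<bar>ln ((g m - g a) / C)\<bar> + 1) / (b - m)"
  have "K > 0"
    unfolding K_def using m by (intro divide_pos_pos) auto
  define \<phi> where "\<phi> r = C * exp (K * (r - b))" for r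
  have "- (K * (b - m)) < ln ((g m - g a) / C)"
    unfolding K_def using m by simp
  then have "exp (K * (m - b)) < (g m - g a) / C"
    using m \<open>C > 0\<close> by (metis diff_gt_0_iff_gt divide_pos_pos exp_less_cancel_iff exp_ln
        minus_diff_eq mult_minus_right)
  then have \<phi>m: "\<phi> m < g m - g a"
    using \<open>C > 0\<close> by (simp add: \<phi>_def field_simps)
  have "continuous_on {a..b} (\<lambda>r. g r - \<phi> r)"
    unfolding \<phi>_def by (intro continuous_intros g_cont)
  then obtain s where s: "s \<in> {a..b}" "\<And>y. y \<in> {a..b} \<Longrightarrow> g y - \<phi> y \<le> g s - \<phi> s"
    using continuous_attains_sup[of "{a..b}" "\<lambda>r. g r - \<phi> r"] \<open>a < b\<close> by fastforce
  have sm: "g m - \<phi> m \<le> g s - \<phi> s"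
    using s(2)[of m] m by simp
  have "\<phi> a > 0"
    using \<open>C > 0\<close> by (simp add: \<phi>_def)
  then have "s \<noteq> a"
    using sm \<phi>m by auto
  have "\<phi> b = C"
    by (simp add: \<phi>_def)
  then have "s \<noteq> b"
    using sm \<phi>m by (auto simp: C_def)
  then have sab: "s \<in> {a<..<b}"
    using s(1) \<open>s \<noteq> a\<close> by auto
  have "L + C * (exp (K * (s - b)) * K) < L"
  proof (rule slope[of "\<lambda>r. L * r + \<phi> r" "\<lambda>r. L + C * (exp (K * (r - b)) * K)" s])
    show "((\<lambda>r. L * r + \<phi> r) has_real_derivative L + C * (exp (K * (r - b)) * K)) (at r)" for r
      unfolding \<phi>_def by (auto intro!: derivative_eq_intros)
    show "continuous_on UNIV (\<lambda>r. L + C * (exp (K * (r - b)) * K))"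
      by (intro continuous_intros)
    show "s \<in> {0<..<1}"
      using sab ab by auto
    show "\<forall>\<^sub>F r in at s. w r - (L * r + \<phi> r) \<le> w s - (L * s + \<phi> s)"
      using sab s(2) by (intro eventually_at_openI[of a s b]) (auto simp: g_def algebra_simps)
  qed
  moreover have "C * (exp (K * (s - b)) * K) > 0"
    using \<open>C > 0\<close> \<open>K > 0\<close> by simp
  ultimately show False
    by linarith
qed

text \<open>Where a subsolution is at least \<open>c\<close>, coercivity bounds the slopes of all functions touching
  it from above; the reflected subsolution gives the Lipschitz estimate in the other direction.\<close>

lemma subsolutions_lipschitz:
  obtains L where "L > 0"
    "\<And>w x y. arc_subsolution lam h w \<Longrightarrow> (\<And>s. s \<in> {0..1} \<Longrightarrow> c \<le> w s) \<Longrightarrow>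
      x \<in> {0..1} \<Longrightarrow> y \<in> {0..1} \<Longrightarrow> \<bar>w x - w y\<bar> \<le> L * \<bar>x - y\<bar>"
proof -
  obtain L where L: "L > 0" "\<And>s p. s \<in> {0..1} \<Longrightarrow> \<bar>p\<bar> \<ge> L \<Longrightarrow> - lam * c < h s p"
    using coercive_bound[of "- lam * c"] by blast
  show thesis
  proof (rule that[OF L(1)])
    fix w :: "real \<Rightarrow> real" and x y :: real
    assume w: "arc_subsolution lam h w" "\<And>s. s \<in> {0..1} \<Longrightarrow> c \<le> w s"
      and xy: "x \<in> {0..1}" "y \<in> {0..1}"
    have one_sided: "v b - v a \<le> L * (b - a)"
      if v: "arc_subsolution lam h' v" "\<And>s. s \<in> {0..1} \<Longrightarrow> c \<le> v s"
        and h': "\<And>s p. s \<in> {0..1} \<Longrightarrow> \<bar>p\<bar> \<ge> L \<Longrightarrow> - lam * c < h' s p"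
        and ab: "0 \<le> a" "a \<le> b" "b \<le> 1" for v h' a b
    proof (rule touching_slopes_imp_one_sided_lipschitz[OF _ _ ab])
      show "continuous_on {0..1} v"
        using v by (simp add: arc_subsolution_def)
      fix \<phi> D s assume \<phi>: "\<And>r. (\<phi> has_real_derivative D r) (at r)" "continuous_on UNIV D"
        and s: "s \<in> {0<..<1::real}" "\<forall>\<^sub>F r in at s. v r - \<phi> r \<le> v s - \<phi> s"
      have "lam * v s + h' s (D s) \<le> 0"
        using v(1) s C1I[OF \<phi>] unfolding arc_subsolution_def by metis
      moreover have "lam * c \<le> lam * v s"
        using v(2) s lam_pos by simp
      ultimately have "h' s (D s) \<le> - lam * c"
        by linarith
      with h'[of s "D s"] s(1) show "D s < L"
        by fastforce
    qed
    have up: "w b - w a \<le> L * (b - a)" if "0 \<le> a" "a \<le> b" "b \<le> 1" for a b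
      by (rule one_sided[OF w(1) _ _ that]) (use w(2) L(2) in auto)
    have down: "w a - w b \<le> L * (b - a)" if "0 \<le> a" "a \<le> b" "b \<le> 1" for a b
    proof -
      have "arc_subsolution lam (\<lambda>s p. h (1 - s) (- p)) (\<lambda>s. w (1 - s))"
        by (rule arc_subsolution_reflect[OF w(1)]) auto
      from one_sided[OF this, of "1 - b" "1 - a"] that show ?thesis
        using w(2) L(2) by auto
    qed
    show "\<bar>w x - w y\<bar> \<le> L * \<bar>x - y\<bar>"
      using up[of x y] up[of y x] down[of x y] down[of y x] xy by (cases "x \<le> y") (auto simp: abs_if)
  qed
qed

section \<open>Comparison\<close>

text \<open>Doubling of variables. At the maximum point of the penalized difference both inequalities hold with
  the same momentum \<open>p\<close>, and coercivity bounds \<open>p\<close> independently of the penalty. The Lipschitz estimate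
  for \<open>w\<close> controls the cost of the shift.\<close>

lemma comparison:
  assumes w: "arc_subsolution lam h w" and v: "arc_supersolution lam h v"
    and bc0: "w 0 \<le> v 0" and bc1: "w 1 \<le> v 1 \<or> state_constraint lam h v"
    and s: "s \<in> {0..1}"
  shows "w s \<le> v s"
proof (rule ccontr)
  assume "\<not> w s \<le> v s"
  have w_cont: "continuous_on {0..1} w" and v_cont: "continuous_on {0..1} v"
    using w v by (auto simp: arc_subsolution_def arc_supersolution_def)
  have "continuous_on {0..1} (\<lambda>s. w s - v s)"
    by (intro continuous_intros w_cont v_cont)
  then obtain s0 where s0: "s0 \<in> {0..1}" "\<And>y. y \<in> {0..1} \<Longrightarrow> w y - v y \<le> w s0 - v s0"
    using continuous_attains_sup[of "{0..1}" "\<lambda>s. w s - v s"] by fastforce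
  define m where "m = w s0 - v s0"
  have "m > 0"
    using s0(2)[OF s] \<open>\<not> w s \<le> v s\<close> by (simp add: m_def)
  then have "s0 > 0"
    using bc0 s0(1) by (cases "s0 = 0") (auto simp: m_def)
  obtain c where c: "\<And>s. s \<in> {0..1} \<Longrightarrow> c \<le> w s"
  proof -
    have "bdd_below (w ` {0..1})"
      using w_cont by (meson compact_Icc compact_continuous_image compact_imp_bounded
          bounded_imp_bdd_below)
    then show thesis
      using that unfolding bdd_below_def by fastforce
  qed
  obtain L where L: "L > 0"
      "\<And>x y. x \<in> {0..1} \<Longrightarrow> y \<in> {0..1} \<Longrightarrow> \<bar>w x - w y\<bar> \<le> L * \<bar>x - y\<bar>"
    using subsolutions_lipschitz[of c] w c by metis
  obtain P where P: "P > 0" "\<And>s p. s \<in> {0..1} \<Longrightarrow> \<bar>p\<bar> \<ge> P \<Longrightarrow> - lam * c < h s p"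
    using coercive_bound[of "- lam * c"] by blast
  have "uniformly_continuous_on ({0..1} \<times> {-P..P}) (\<lambda>(s, p). h s p)"
    by (intro compact_uniformly_continuous compact_Times compact_Icc continuous_on_subset[OF h_cont])
      auto
  moreover have "lam * m / 2 > 0"
    using lam_pos \<open>m > 0\<close> by simp
  ultimately obtain d1 where d1: "d1 > 0"
    "\<And>z z'. z \<in> {0..1} \<times> {-P..P} \<Longrightarrow> z' \<in> {0..1} \<times> {-P..P} \<Longrightarrow> dist z' z < d1 \<Longrightarrow>
      dist ((\<lambda>(s, p). h s p) z') ((\<lambda>(s, p). h s p) z) < lam * m / 2"
    unfolding uniformly_continuous_on_def by metis
  have h_close: "\<bar>h x p - h y p\<bar> < lam * m / 2"
    if "x \<in> {0..1}" "y \<in> {0..1}" "\<bar>p\<bar> \<le> P" "\<bar>x - y\<bar> < d1" for x y p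
    using d1(2)[of "(y, p)" "(x, p)"] that by (auto simp: dist_Pair_Pair dist_real_def abs_le_iff)
  obtain d2 where d2: "d2 > 0" "\<And>y. y \<in> {0..1} \<Longrightarrow> y < d2 \<Longrightarrow> \<bar>v y - v 0\<bar> < m / 2"
  proof -
    have "\<exists>d>0. \<forall>y\<in>{0..1}. dist y 0 < d \<longrightarrow> dist (v y) (v 0) < m / 2"
      using v_cont \<open>m > 0\<close> unfolding continuous_on_iff by (meson atLeastAtMost_iff half_gt_zero
        order_refl zero_le_one)
    then show thesis
      using that by (auto simp: dist_real_def)
  qed
  define e where "e = Min {s0, m / (4 * L), 1 / (4 * L), d1 / 4, d2 / 4}"
  have e: "0 < e" "e \<le> s0" "e \<le> m / (4 * L)" "e \<le> 1 / (4 * L)" "e \<le> d1 / 4" "e \<le> d2 / 4"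
    using \<open>s0 > 0\<close> \<open>m > 0\<close> L(1) d1(1) d2(1) by (auto simp: e_def)
  have Le: "L * e \<le> m / 4" "L * e \<le> 1 / 4"
    using e(3,4) L(1) by (auto simp: field_simps)
  \<comment> \<open>The shift by \<open>e\<close> puts the maximum point at \<open>x < y\<close>. So the point \<open>x\<close> for the subsolution,
    which satisfies nothing at \<open>1\<close>, is interior even if \<open>y = 1\<close>, where the state constraint
    takes over.\<close>
  define \<Phi> where "\<Phi> z = w (fst z) - v (snd z) - (fst z - snd z + e)\<^sup>2 / e\<^sup>2" for z
  have "continuous_on ({0..1} \<times> {0..1}) \<Phi>"
    unfolding \<Phi>_def using e(1)
    by (intro continuous_intros continuous_on_compose2[OF w_cont] continuous_on_compose2[OF v_cont])
      auto
  moreover have "compact ({0..1::real} \<times> {0..1::real})"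
    by (intro compact_Times compact_Icc)
  ultimately obtain z where z: "z \<in> {0..1} \<times> {0..1}" "\<And>z'. z' \<in> {0..1} \<times> {0..1} \<Longrightarrow> \<Phi> z' \<le> \<Phi> z"
    using continuous_attains_sup[of "{0..1} \<times> {0..1}" \<Phi>] by fastforce
  define x y where "x = fst z" "y = snd z"
  have xy: "x \<in> {0..1}" "y \<in> {0..1}"
    using z(1) by (auto simp: x_y_def)
  have max: "w x' - v y' - (x' - y' + e)\<^sup>2 / e\<^sup>2 \<le> w x - v y - (x - y + e)\<^sup>2 / e\<^sup>2"
    if "x' \<in> {0..1}" "y' \<in> {0..1}" for x' y'
    using z(2)[of "(x', y')"] that by (simp add: \<Phi>_def x_y_def)
  define t where "t = x - y + e"
  have low: "m - L * e \<le> w x - v y - t\<^sup>2 / e\<^sup>2"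
  proof -
    have "\<bar>w (s0 - e) - w s0\<bar> \<le> L * \<bar>s0 - e - s0\<bar>"
      using e s0(1) by (intro L(2)) auto
    then have "m - L * e \<le> w (s0 - e) - v s0"
      using e(1) by (simp add: m_def)
    also have "\<dots> \<le> w x - v y - t\<^sup>2 / e\<^sup>2"
      using max[of "s0 - e" s0] e s0(1) by (simp add: t_def)
    finally show ?thesis .
  qed
  have wv: "m - L * e \<le> w x - v y"
  proof -
    have "t\<^sup>2 / e\<^sup>2 \<ge> 0" by simp
    with low show ?thesis by linarith
  qed
  have "\<bar>t\<bar> < e"
  proof (rule ccontr)
    assume "\<not> \<bar>t\<bar> < e"
    have "w x - v y \<le> L * \<bar>x - y\<bar> + m"
      using s0(2)[OF xy(2)] L(2)[OF xy] by (auto simp: m_def)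
    with low have "t\<^sup>2 / e\<^sup>2 \<le> L * (\<bar>x - y\<bar> + e)"
      by (simp add: algebra_simps)
    also have "\<dots> \<le> L * (3 * \<bar>t\<bar>)"
    proof (rule mult_left_mono)
      show "\<bar>x - y\<bar> + e \<le> 3 * \<bar>t\<bar>"
      proof -
        have "\<bar>x - y\<bar> \<le> \<bar>t\<bar> + e"
          using e(1) by (simp add: t_def)
        then show ?thesis
          using \<open>\<not> \<bar>t\<bar> < e\<close> by linarith
      qed
    qed (use L(1) in simp)
    finally have "\<bar>t\<bar> * \<bar>t\<bar> \<le> (L * 3 * e\<^sup>2) * \<bar>t\<bar>"
      using e(1) by (simp add: field_simps power2_eq_square)
    moreover have "\<bar>t\<bar> > 0"
      using \<open>\<not> \<bar>t\<bar> < e\<close> e(1) by linarith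
    ultimately have "\<bar>t\<bar> \<le> L * 3 * e\<^sup>2"
      using mult_right_le_imp_le by blast
    also have "\<dots> = 3 * (L * e) * e"
      by (simp add: power2_eq_square)
    also have "\<dots> \<le> 3 * (1 / 4) * e"
      using Le e(1) by (intro mult_right_mono mult_left_mono) auto
    also have "\<dots> < e"
      using e(1) by simp
    finally show False
      using \<open>\<not> \<bar>t\<bar> < e\<close> by simp
  qed
  then have xy': "x < y" "y - x < 2 * e"
    by (auto simp: t_def)
  have "x > 0"
  proof (rule ccontr)
    assume "\<not> x > 0"
    then have "x = 0" using xy by simp
    then have "\<bar>v y - v 0\<bar> < m / 2"
      using xy' e d2(1) xy by (intro d2(2)) auto
    then have "v 0 - v y < m / 2"
      by linarith
    moreover have "m - L * e \<le> w 0 - v y"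
      using wv \<open>x = 0\<close> by simp
    ultimately show False
      using Le(1) bc0 \<open>m > 0\<close> by linarith
  qed
  define p where "p = 2 * t / e\<^sup>2"
  have sub: "lam * w x + h x p \<le> 0"
  proof -
    have "lam * w x + h x (2 * (x - y + e) / e\<^sup>2) \<le> 0"
    proof (rule arc_subsolutionD[OF w, of 0 1 x "\<lambda>r. (r - y + e)\<^sup>2 / e\<^sup>2"
          "\<lambda>r. 2 * (r - y + e) / e\<^sup>2"])
      show "((\<lambda>r. (r - y + e)\<^sup>2 / e\<^sup>2) has_real_derivative 2 * (r - y + e) / e\<^sup>2) (at r)" for r
        by (rule DERIV_cdivide) (auto intro!: derivative_eq_intros)
      show "continuous_on UNIV (\<lambda>r. 2 * (r - y + e) / e\<^sup>2)"
        using e(1) by (intro continuous_intros) auto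
      show "x \<in> {0<..<1}"
        using \<open>x > 0\<close> xy xy' by auto
      show "w r - (r - y + e)\<^sup>2 / e\<^sup>2 \<le> w x - (x - y + e)\<^sup>2 / e\<^sup>2" if "r \<in> {0<..<1}" for r
        using max[of r y] xy that by auto
    qed auto
    then show ?thesis by (simp add: p_def t_def)
  qed
  have super: "lam * v y + h y p \<ge> 0"
  proof -
    let ?\<phi> = "\<lambda>r. - ((x - r + e)\<^sup>2 / e\<^sup>2)" and ?D = "\<lambda>r. 2 * (x - r + e) / e\<^sup>2"
    have D: "(?\<phi> has_real_derivative ?D r) (at r)" for r
    proof -
      have "((\<lambda>r. - (x - r + e)\<^sup>2) has_real_derivative 2 * (x - r + e)) (at r)"
        by (auto intro!: derivative_eq_intros)
      from DERIV_cdivide[OF this, of "e\<^sup>2"] show ?thesis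
        by simp
    qed
    have D_cont: "continuous_on UNIV ?D"
      using e(1) by (intro continuous_intros) auto
    have touch: "v r - ?\<phi> r \<ge> v y - ?\<phi> y" if "r \<in> {0<..<1}" for r
      using max[of x r] xy that by auto
    have "lam * v y + h y (?D y) \<ge> 0"
    proof (cases "y = 1")
      case False
      then have "y \<in> {0<..<1}"
        using xy xy' \<open>x > 0\<close> by auto
      from arc_supersolutionD[OF v _ _ this D D_cont touch] show ?thesis
        by simp
    next
      case True
      have "\<not> w 1 \<le> v 1"
      proof
        assume "w 1 \<le> v 1"
        have "\<bar>w x - w 1\<bar> \<le> L * \<bar>x - 1\<bar>"
          using xy by (intro L(2)) auto
        also have "\<dots> \<le> L * (2 * e)"
          using L(1) True xy' by (intro mult_left_mono) auto
        finally show False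
          using wv Le True \<open>w 1 \<le> v 1\<close> \<open>m > 0\<close> by (simp add: algebra_simps)
      qed
      with bc1 have "state_constraint lam h v"
        by simp
      then have "lam * v 1 + h 1 (?D 1) \<ge> 0"
        by (rule state_constraintD[of _ _ _ 0, OF _ _ D D_cont]) (use touch True in auto)
      with True show ?thesis by simp
    qed
    then show ?thesis by (simp add: p_def t_def)
  qed
  have "lam * c \<le> lam * w x"
    using c[OF xy(1)] lam_pos by simp
  with sub have "h x p \<le> - lam * c"
    by linarith
  then have "\<bar>p\<bar> \<le> P"
    using P(2)[OF xy(1), of p] by fastforce
  then have "\<bar>h y p - h x p\<bar> < lam * m / 2"
    using xy xy' e(5) d1(1) by (intro h_close) auto
  then have "lam * (w x - v y) < lam * (m / 2)"
    using sub super abs_ge_self[of "h y p - h x p"] by (simp add: right_diff_distrib)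
  then have "w x - v y < m / 2"
    using lam_pos by simp
  then show False
    using wv Le \<open>m > 0\<close> by linarith
qed

section \<open>Perron's method\<close>

text \<open>The largest subsolution with prescribed upper bounds at both end points. The bound at \<open>1\<close> is
  void if it exceeds all subsolutions, so that this covers \<^const>\<open>maximal_subsolution\<close> as well.\<close>

definition perron :: "real \<Rightarrow> real \<Rightarrow> real \<Rightarrow> real" where
  "perron \<alpha> \<beta> s = Sup {w s | w. arc_subsolution lam h w \<and> w 0 \<le> \<alpha> \<and> w 1 \<le> \<beta>}"

lemma perron_upper:
  assumes "arc_subsolution lam h w" "w 0 \<le> \<alpha>" "w 1 \<le> \<beta>" "s \<in> {0..1}"
  shows "w s \<le> perron \<alpha> \<beta> s"
proof -
  obtain M where "\<And>w s. arc_subsolution lam h w \<Longrightarrow> s \<in> {0..1} \<Longrightarrow> w s \<le> M"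
    using subsolutions_bounded_above by blast
  then have "bdd_above {w s | w. arc_subsolution lam h w \<and> w 0 \<le> \<alpha> \<and> w 1 \<le> \<beta>}"
    using assms(4) by (intro bdd_aboveI[of _ M]) auto
  then show ?thesis
    unfolding perron_def using assms by (intro cSup_upper) auto
qed

lemma perron_least:
  assumes "\<And>w. arc_subsolution lam h w \<Longrightarrow> w 0 \<le> \<alpha> \<Longrightarrow> w 1 \<le> \<beta> \<Longrightarrow> w s \<le> B"
  shows "perron \<alpha> \<beta> s \<le> B"
proof -
  obtain c0 where c0: "\<And>c. c \<le> c0 \<Longrightarrow> arc_subsolution lam h (\<lambda>_. c)"
    using constant_subsolutions by blast
  have "arc_subsolution lam h (\<lambda>_. min c0 (min \<alpha> \<beta>))"
    by (rule c0) simp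
  then have "{w s | w. arc_subsolution lam h w \<and> w 0 \<le> \<alpha> \<and> w 1 \<le> \<beta>} \<noteq> {}"
    by fastforce
  then show ?thesis
    unfolding perron_def using assms by (intro cSup_least) auto
qed

lemma perron_approx:
  assumes "B < perron \<alpha> \<beta> s"
  obtains w where "arc_subsolution lam h w" "w 0 \<le> \<alpha>" "w 1 \<le> \<beta>" "B < w s"
  using assms perron_least[of \<alpha> \<beta> s B] by (meson not_le)

lemma perron_end_points: "perron \<alpha> \<beta> 0 \<le> \<alpha>" "perron \<alpha> \<beta> 1 \<le> \<beta>"
  by (auto intro: perron_least)

text \<open>The members of the family that lie above a constant subsolution are equi-Lipschitz, and
  restricting to them does not change the supremum.\<close>

lemma perron_lipschitz:
  obtains L where "L > 0"
    "\<And>x y. x \<in> {0..1} \<Longrightarrow> y \<in> {0..1} \<Longrightarrow> perron \<alpha> \<beta> x \<le> perron \<alpha> \<beta> y + L * \<bar>x - y\<bar>"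
proof -
  obtain c0 where c0: "\<And>c. c \<le> c0 \<Longrightarrow> arc_subsolution lam h (\<lambda>_. c)"
    using constant_subsolutions by blast
  define c where "c = min c0 (min \<alpha> \<beta>)"
  have c: "arc_subsolution lam h (\<lambda>_. c)" "c \<le> \<alpha>" "c \<le> \<beta>"
    by (auto simp: c_def intro: c0)
  obtain L where L: "L > 0"
    "\<And>w x y. arc_subsolution lam h w \<Longrightarrow> (\<And>s. s \<in> {0..1} \<Longrightarrow> c \<le> w s) \<Longrightarrow>
      x \<in> {0..1} \<Longrightarrow> y \<in> {0..1} \<Longrightarrow> \<bar>w x - w y\<bar> \<le> L * \<bar>x - y\<bar>"
    using subsolutions_lipschitz[of c] by blast
  show thesis
  proof (rule that[OF L(1)])
    fix x y :: real assume xy: "x \<in> {0..1}" "y \<in> {0..1}"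
    show "perron \<alpha> \<beta> x \<le> perron \<alpha> \<beta> y + L * \<bar>x - y\<bar>"
    proof (rule perron_least)
      fix w assume w: "arc_subsolution lam h w" "w 0 \<le> \<alpha>" "w 1 \<le> \<beta>"
      have sub: "arc_subsolution lam h (\<lambda>s. max (w s) c)"
        by (rule arc_subsolution_max[OF w(1) c(1)])
      have "\<bar>max (w x) c - max (w y) c\<bar> \<le> L * \<bar>x - y\<bar>"
        by (rule L(2)[OF sub _ xy]) auto
      moreover have "max (w y) c \<le> perron \<alpha> \<beta> y"
        using perron_upper[OF sub, of \<alpha> \<beta> y] w c xy by auto
      ultimately show "w x \<le> perron \<alpha> \<beta> y + L * \<bar>x - y\<bar>"
        by linarith
    qed
  qed
qed

lemma continuous_on_perron: "continuous_on {0..1} (perron \<alpha> \<beta>)"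
proof -
  obtain L where L: "L > 0"
    "\<And>x y. x \<in> {0..1} \<Longrightarrow> y \<in> {0..1} \<Longrightarrow> perron \<alpha> \<beta> x \<le> perron \<alpha> \<beta> y + L * \<bar>x - y\<bar>"
    using perron_lipschitz by blast
  have "L-lipschitz_on {0..1} (perron \<alpha> \<beta>)"
  proof (rule lipschitz_onI)
    fix x y :: real assume "x \<in> {0..1}" "y \<in> {0..1}"
    with L(2)[of x y] L(2)[of y x] show "dist (perron \<alpha> \<beta> x) (perron \<alpha> \<beta> y) \<le> L * dist x y"
      by (auto simp: dist_real_def abs_minus_commute abs_le_iff)
  qed (use L(1) in simp)
  then show ?thesis
    by (rule lipschitz_on_continuous_on)
qed

text \<open>This extends a strict inequality at a contact point to a neighbourhood.\<close>

lemma equation_continuous: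
  assumes "continuous_on UNIV D" "continuous_on {0..1} \<psi>"
  shows "continuous_on {0..1} (\<lambda>r. lam * \<psi> r + h r (D r))"
proof -
  have "continuous_on {0..1} (\<lambda>r. (r, D r))"
    by (intro continuous_intros continuous_on_subset[OF assms(1)]) auto
  from continuous_on_compose2[OF h_cont this] have "continuous_on {0..1} (\<lambda>r. h r (D r))"
    by (simp add: image_subset_iff)
  then show ?thesis
    by (intro continuous_intros assms(2))
qed

text \<open>If the equation failed at a contact point \<open>s\<close>, it would fail with the strict test function
  \<open>\<phi> + (r - s)\<^sup>2\<close> near \<open>s\<close>. A member of the family that almost attains the supremum at \<open>s\<close> is touched by
  that test function near \<open>s\<close>, at almost the same value.\<close>

lemma arc_subsolution_perron: "arc_subsolution lam h (perron \<alpha> \<beta>)"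
  unfolding arc_subsolution_def
proof (intro conjI ballI allI impI)
  let ?W = "perron \<alpha> \<beta>"
  fix s :: real and \<phi> assume s: "s \<in> {0<..<1}" and \<phi>: "\<phi> C1_differentiable_on UNIV"
    and "\<forall>\<^sub>F r in at s. ?W r - \<phi> r \<le> ?W s - \<phi> s"
  then obtain d0 where d0: "d0 > 0" "\<And>r. r \<noteq> s \<Longrightarrow> dist r s < d0 \<Longrightarrow> ?W r - \<phi> r \<le> ?W s - \<phi> s"
    unfolding eventually_at by auto
  have D\<phi>: "(\<phi> has_real_derivative deriv \<phi> r) (at r)" "continuous_on UNIV (deriv \<phi>)" for r
    using \<phi> by (auto simp: C1_iff_real_derivative)
  have \<phi>_cont: "continuous_on A \<phi>" for A
    using D\<phi>(1) by (meson DERIV_continuous_on has_field_derivative_at_within)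
  define D where "D r = deriv \<phi> r + 2 * (r - s)" for r
  have D_cont: "continuous_on UNIV D"
    unfolding D_def by (intro continuous_intros D\<phi>)
  show "lam * ?W s + h s (deriv \<phi> s) \<le> 0"
  proof (rule ccontr)
    assume neg: "\<not> lam * ?W s + h s (deriv \<phi> s) \<le> 0"
    define k where "k = lam * ?W s + h s (deriv \<phi> s)"
    have k: "k > 0"
      using neg by (simp add: k_def)
    define f where "f r = lam * (?W s + \<phi> r - \<phi> s) + h r (D r)" for r
    have "continuous_on {0..1} f"
      unfolding f_def by (intro equation_continuous D_cont continuous_intros \<phi>_cont)
    moreover have "f s = k"
      by (simp add: f_def k_def D_def)
    ultimately obtain d1 where d1: "d1 > 0" "\<And>r. r \<in> {0..1} \<Longrightarrow> dist r s < d1 \<Longrightarrow> dist (f r) k < k / 2"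
      using s k unfolding continuous_on_iff by (metis atLeastAtMost_iff greaterThanLessThan_iff
          half_gt_zero less_imp_le)
    define \<delta> where "\<delta> = Min {d0 / 2, d1 / 2, s, 1 - s}"
    have \<delta>: "\<delta> > 0" "\<delta> < d0" "\<delta> < d1" "\<delta> \<le> s" "\<delta> \<le> 1 - s"
      using d0(1) d1(1) s by (auto simp: \<delta>_def min_def)
    define \<eta> where "\<eta> = min (\<delta>\<^sup>2 / 2) (k / (2 * lam))"
    have \<eta>: "\<eta> > 0" "\<eta> < \<delta>\<^sup>2" "lam * \<eta> \<le> k / 2"
      using \<delta>(1) k lam_pos by (auto simp: \<eta>_def min_def field_simps)
    obtain w where w: "arc_subsolution lam h w" "w 0 \<le> \<alpha>" "w 1 \<le> \<beta>" "?W s - \<eta> < w s"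
      using perron_approx[of "?W s - \<eta>" \<alpha> \<beta> s] \<eta>(1) by auto
    define \<psi> where "\<psi> r = \<phi> r + (r - s)\<^sup>2" for r
    have "continuous_on {s - \<delta>..s + \<delta>} w"
      using w(1) \<delta> by (auto simp: arc_subsolution_def intro: continuous_on_subset)
    then have "continuous_on {s - \<delta>..s + \<delta>} (\<lambda>r. w r - \<psi> r)"
      unfolding \<psi>_def by (intro continuous_intros \<phi>_cont)
    then obtain r where r: "r \<in> {s - \<delta>..s + \<delta>}"
        "\<And>y. y \<in> {s - \<delta>..s + \<delta>} \<Longrightarrow> w y - \<psi> y \<le> w r - \<psi> r"
      using continuous_attains_sup[of "{s - \<delta>..s + \<delta>}" "\<lambda>r. w r - \<psi> r"] \<delta>(1) by fastforce
    have r01: "r \<in> {0..1}"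
      using r(1) \<delta> by auto
    have wr: "w s - \<phi> s \<le> w r - \<phi> r - (r - s)\<^sup>2"
      using r(2)[of s] \<delta>(1) by (simp add: \<psi>_def)
    have "?W r - \<phi> r \<le> ?W s - \<phi> s"
      using d0(2)[of r] r(1) \<delta> by (cases "r = s") (auto simp: dist_real_def)
    moreover have "w r \<le> ?W r"
      using perron_upper[OF w(1-3) r01] .
    ultimately have "(r - s)\<^sup>2 < \<delta>\<^sup>2"
      using wr w(4) \<eta>(2) by linarith
    then have "\<bar>r - s\<bar> < \<delta>"
      using \<delta>(1) by (metis abs_of_pos power2_abs power2_less_imp_less less_imp_le)
    then have rin: "r \<in> {s - \<delta><..<s + \<delta>}"
      by auto
    have "lam * w r + h r (D r) \<le> 0"
    proof (rule arc_subsolutionD[OF w(1) _ _ rin])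
      show "(\<psi> has_real_derivative D r) (at r)" for r
        unfolding \<psi>_def D_def by (auto intro!: derivative_eq_intros D\<phi>)
    qed (use r \<delta> D_cont in auto)
    moreover have "?W s - \<eta> + \<phi> r - \<phi> s \<le> w r"
      using wr w(4) zero_le_power2[of "r - s"] by linarith
    then have "lam * (?W s - \<eta> + \<phi> r - \<phi> s) \<le> lam * w r"
      using lam_pos by simp
    ultimately have "f r \<le> lam * \<eta>"
      by (simp add: f_def algebra_simps)
    moreover have "dist (f r) k < k / 2"
      using r01 \<open>\<bar>r - s\<bar> < \<delta>\<close> \<delta> by (intro d1(2)) (auto simp: dist_real_def)
    then have "f r > k / 2"
      by (simp add: dist_real_def abs_if split: if_splits)
    ultimately show False
      using \<eta>(3) by linarith
  qed
qed (rule continuous_on_perron)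

text \<open>Raising a subsolution \<open>w\<close>: if a function \<open>\<phi>\<close> touches \<open>w\<close> from below at \<open>s\<close> and fails the
  supersolution inequality there, then \<open>\<phi> + \<eta> - (r - s)\<^sup>2\<close> is a strict subsolution near \<open>s\<close> which for small
  \<open>\<eta>\<close> exceeds \<open>w\<close> only near \<open>s\<close>. The point \<open>s = 1\<close> is included, with contact from the left.\<close>

lemma arc_subsolution_bump:
  assumes w: "arc_subsolution lam h w" and s: "s \<in> {0<..1}"
    and \<phi>: "\<phi> C1_differentiable_on UNIV" "\<phi> s = w s"
    and \<delta>: "\<delta> > 0" "\<And>r. r \<in> {0..1} \<Longrightarrow> \<bar>r - s\<bar> < \<delta> \<Longrightarrow> \<phi> r \<le> w r"
    and fail: "lam * \<phi> s + h s (deriv \<phi> s) < 0"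
    and \<epsilon>: "\<epsilon> > 0"
  obtains v where "arc_subsolution lam h v" "v s > w s" "v s \<le> w s + \<epsilon>"
    "\<And>r. r \<in> {0..1} \<Longrightarrow> \<bar>r - s\<bar> \<ge> \<delta> \<Longrightarrow> v r = w r"
proof -
  have D\<phi>: "(\<phi> has_real_derivative deriv \<phi> r) (at r)" "continuous_on UNIV (deriv \<phi>)" for r
    using \<phi> by (auto simp: C1_iff_real_derivative)
  have \<phi>_cont: "continuous_on A \<phi>" for A
    using D\<phi>(1) by (meson DERIV_continuous_on has_field_derivative_at_within)
  define D where "D r = deriv \<phi> r - 2 * (r - s)" for r
  have D_cont: "continuous_on UNIV D"
    unfolding D_def by (intro continuous_intros D\<phi>)
  define k where "k = - (lam * \<phi> s + h s (deriv \<phi> s))"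
  have k: "k > 0"
    using fail by (simp add: k_def)
  define f where "f r = lam * \<phi> r + h r (D r)" for r
  have "continuous_on {0..1} f"
    unfolding f_def by (intro equation_continuous D_cont \<phi>_cont)
  moreover have "f s = - k"
    by (simp add: f_def k_def D_def)
  ultimately obtain d1 where d1: "d1 > 0" "\<And>r. r \<in> {0..1} \<Longrightarrow> dist r s < d1 \<Longrightarrow> dist (f r) (- k) < k / 2"
    using s k unfolding continuous_on_iff by (metis atLeastAtMost_iff greaterThanAtMost_iff
        half_gt_zero less_imp_le)
  define \<rho> where "\<rho> = min (\<delta> / 2) (d1 / 2)"
  have \<rho>: "\<rho> > 0" "\<rho> < \<delta>" "\<rho> < d1"
    using \<delta>(1) d1(1) by (auto simp: \<rho>_def min_def)
  define \<eta> where "\<eta> = Min {\<epsilon>, \<rho>\<^sup>2, k / (2 * lam)}"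
  have \<eta>: "\<eta> > 0" "\<eta> \<le> \<epsilon>" "\<eta> \<le> \<rho>\<^sup>2" "\<eta> \<le> k / (2 * lam)"
    using \<epsilon> \<rho>(1) k lam_pos by (auto simp: \<eta>_def)
  have lam_\<eta>: "lam * \<eta> \<le> k / 2"
    using \<eta>(4) lam_pos by (simp add: field_simps)
  define \<psi> where "\<psi> r = \<phi> r + \<eta> - (r - s)\<^sup>2" for r
  have \<psi>_cont: "continuous_on A \<psi>" for A
    unfolding \<psi>_def by (intro continuous_intros \<phi>_cont)
  have D\<psi>: "(\<psi> has_real_derivative D r) (at r)" for r
    unfolding \<psi>_def D_def by (auto intro!: derivative_eq_intros D\<phi>)
  \<comment> \<open>At distance \<open>\<rho>\<close> the parabola has lost at least what \<open>\<eta>\<close> gains, so \<open>max w \<psi>\<close> joins \<open>w\<close> continuously.\<close>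
  have far: "\<psi> r \<le> w r" if "r \<in> {0..1}" "\<bar>r - s\<bar> \<ge> \<rho>" "\<bar>r - s\<bar> < \<delta>" for r
  proof -
    have "\<rho>\<^sup>2 \<le> (r - s)\<^sup>2"
      using that \<rho>(1) by (metis abs_le_square_iff abs_of_pos)
    then show ?thesis
      using \<delta>(2)[of r] that \<eta>(3) by (simp add: \<psi>_def)
  qed
  define v where "v r = (if \<bar>r - s\<bar> \<le> \<rho> then max (w r) (\<psi> r) else w r)" for r
  have v_ge: "w r \<le> v r" for r
    by (simp add: v_def)
  have v_ge\<psi>: "\<psi> r \<le> v r" if "r \<in> {0..1}" "\<bar>r - s\<bar> < \<delta>" for r
    using far[OF that(1)] that by (auto simp: v_def)
  have w_cont: "continuous_on {0..1} w"
    using w by (simp add: arc_subsolution_def)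
  have v_sub: "arc_subsolution lam h v"
    unfolding arc_subsolution_def
  proof (intro conjI ballI allI impI)
    have "continuous_on ({r \<in> {0..1}. \<bar>r - s\<bar> \<le> \<rho>} \<union> {r \<in> {0..1}. \<bar>r - s\<bar> \<ge> \<rho>}) v"
      unfolding v_def
    proof (rule continuous_on_cases)
      show "closed {r \<in> {0..1}. \<bar>r - s\<bar> \<le> \<rho>}" "closed {r \<in> {0..1}. \<bar>r - s\<bar> \<ge> \<rho>}"
        by (auto intro!: closed_Collect_conj closed_Collect_le continuous_intros
            simp flip: atLeastAtMost_iff simp: Collect_conj_eq)
      show "continuous_on {r \<in> {0..1}. \<bar>r - s\<bar> \<le> \<rho>} (\<lambda>r. max (w r) (\<psi> r))"
        by (intro continuous_intros \<psi>_cont continuous_on_subset[OF w_cont]) auto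
      show "continuous_on {r \<in> {0..1}. \<bar>r - s\<bar> \<ge> \<rho>} w"
        by (rule continuous_on_subset[OF w_cont]) auto
      have "max (w r) (\<psi> r) = w r" if "r \<in> {0..1}" "\<bar>r - s\<bar> = \<rho>" for r
        using far[OF that(1)] that(2) \<rho>(2) by simp
      then show "\<forall>r. r \<in> {r \<in> {0..1}. \<bar>r - s\<bar> \<le> \<rho>} \<and> \<not> \<bar>r - s\<bar> \<le> \<rho> \<or>
          r \<in> {r \<in> {0..1}. \<bar>r - s\<bar> \<ge> \<rho>} \<and> \<bar>r - s\<bar> \<le> \<rho> \<longrightarrow> max (w r) (\<psi> r) = w r"
        by force
    qed
    moreover have "{r \<in> {0..1}. \<bar>r - s\<bar> \<le> \<rho>} \<union> {r \<in> {0..1}. \<bar>r - s\<bar> \<ge> \<rho>} = {0..1}"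
      by auto
    ultimately show "continuous_on {0..1} v"
      by simp
  next
    fix x :: real and \<theta> assume x: "x \<in> {0<..<1}" and \<theta>: "\<theta> C1_differentiable_on UNIV"
      and touch: "\<forall>\<^sub>F r in at x. v r - \<theta> r \<le> v x - \<theta> x"
    show "lam * v x + h x (deriv \<theta> x) \<le> 0"
    proof (cases "v x = w x")
      case True
      have "\<forall>\<^sub>F r in at x. w r - \<theta> r \<le> w x - \<theta> x"
      proof (rule eventually_mono[OF touch])
        fix r assume "v r - \<theta> r \<le> v x - \<theta> x"
        then show "w r - \<theta> r \<le> w x - \<theta> x"
          using v_ge[of r] True by linarith
      qed
      then show ?thesis
        using w x \<theta> True unfolding arc_subsolution_def by auto
    next
      case False
      then have x\<rho>: "\<bar>x - s\<bar> \<le> \<rho>" and vx: "v x = \<psi> x"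
        by (auto simp: v_def max_def split: if_splits)
      define d where "d = min (\<delta> - \<rho>) (min x (1 - x))"
      have d: "d > 0"
        using \<rho>(2) x by (auto simp: d_def)
      have "\<forall>\<^sub>F r in at x. \<psi> r \<le> v r"
        using d x x\<rho> by (intro eventually_at_openI[of "x - d" x "x + d"] v_ge\<psi>) (auto simp: d_def)
      with touch have "\<forall>\<^sub>F r in at x. \<psi> r - \<theta> r \<le> \<psi> x - \<theta> x"
        by eventually_elim (use vx in auto)
      then obtain d2 where d2: "d2 > 0" "\<And>r. r \<noteq> x \<Longrightarrow> dist r x < d2 \<Longrightarrow> \<psi> r - \<theta> r \<le> \<psi> x - \<theta> x"
        unfolding eventually_at by auto
      have "D x - deriv \<theta> x = 0"
      proof (rule DERIV_local_max)
        show "((\<lambda>r. \<psi> r - \<theta> r) has_real_derivative D x - deriv \<theta> x) (at x)"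
          using \<theta> D\<psi> by (auto intro!: DERIV_diff simp: C1_iff_real_derivative)
        show "\<forall>y. \<bar>x - y\<bar> < d2 \<longrightarrow> \<psi> y - \<theta> y \<le> \<psi> x - \<theta> x"
          using d2(2) by (metis abs_minus_commute dist_real_def order_refl)
      qed (rule d2)
      moreover have "dist (f x) (- k) < k / 2"
        using x x\<rho> \<rho> by (intro d1(2)) (auto simp: dist_real_def)
      then have "f x < - k / 2"
        by (simp add: dist_real_def abs_if split: if_splits)
      moreover have "lam * \<psi> x \<le> lam * (\<phi> x + \<eta>)"
        using lam_pos by (simp add: \<psi>_def)
      ultimately show ?thesis
        using vx lam_\<eta> by (simp add: f_def algebra_simps)
    qed
  qed
  show thesis
  proof (rule that[OF v_sub])
    show "v s > w s" "v s \<le> w s + \<epsilon>"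
      using \<eta> \<rho>(1) \<phi>(2) \<epsilon> by (auto simp: v_def \<psi>_def)
    show "v r = w r" if "r \<in> {0..1}" "\<bar>r - s\<bar> \<ge> \<delta>" for r
      using that \<rho> by (simp add: v_def)
  qed
qed

lemma arc_supersolution_perron: "arc_supersolution lam h (perron \<alpha> \<beta>)"
  unfolding arc_supersolution_def
proof (intro conjI ballI allI impI)
  let ?W = "perron \<alpha> \<beta>"
  fix s :: real and \<phi> assume s: "s \<in> {0<..<1}" and \<phi>: "\<phi> C1_differentiable_on UNIV"
    and "\<forall>\<^sub>F r in at s. ?W r - \<phi> r \<ge> ?W s - \<phi> s"
  then obtain d where d: "d > 0" "\<And>r. r \<noteq> s \<Longrightarrow> dist r s < d \<Longrightarrow> ?W r - \<phi> r \<ge> ?W s - \<phi> s"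
    unfolding eventually_at by auto
  define \<psi> where "\<psi> r = \<phi> r + (?W s - \<phi> s)" for r
  have "(\<psi> has_real_derivative deriv \<phi> r) (at r)" for r
    unfolding \<psi>_def using \<phi> by (auto intro!: derivative_eq_intros simp: C1_iff_real_derivative)
  then have \<psi>: "\<psi> C1_differentiable_on UNIV" "deriv \<psi> = deriv \<phi>"
    using C1I[of \<psi> "deriv \<phi>"] \<phi> by (auto simp: C1_iff_real_derivative)
  show "lam * ?W s + h s (deriv \<phi> s) \<ge> 0"
  proof (rule ccontr)
    assume neg: "\<not> ?thesis"
    \<comment> \<open>The neighbourhood stays away from both end points, so the end point values are unchanged.\<close>
    define \<delta> where "\<delta> = Min {d, s, 1 - s}"
    have \<delta>: "\<delta> > 0" "\<delta> \<le> d" "\<delta> \<le> s" "\<delta> \<le> 1 - s"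
      using d(1) s by (auto simp: \<delta>_def)
    obtain v where v: "arc_subsolution lam h v" "v s > ?W s"
        "\<And>r. r \<in> {0..1} \<Longrightarrow> \<bar>r - s\<bar> \<ge> \<delta> \<Longrightarrow> v r = ?W r"
    proof (rule arc_subsolution_bump[OF arc_subsolution_perron _ \<psi>(1) _ \<delta>(1), of s \<alpha> \<beta> 1])
      show "s \<in> {0<..1}" "\<psi> s = ?W s" "lam * \<psi> s + h s (deriv \<psi> s) < 0"
        using s neg by (auto simp: \<psi>_def \<psi>(2))
      show "\<psi> r \<le> ?W r" if "r \<in> {0..1}" "\<bar>r - s\<bar> < \<delta>" for r
        using d(2)[of r] that \<delta> by (cases "r = s") (auto simp: \<psi>_def dist_real_def)
    qed auto
    have "v 0 \<le> \<alpha>" "v 1 \<le> \<beta>"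
      using v(3)[of 0] v(3)[of 1] \<delta> s perron_end_points by auto
    then have "v s \<le> ?W s"
      using v(1) s by (intro perron_upper) auto
    with v(2) show False by simp
  qed
qed (rule continuous_on_perron)

text \<open>A failing state constraint lets a bump raise the value at \<open>1\<close>, and a bound that is not active
  leaves room for it.\<close>

lemma state_constraint_perron:
  assumes "perron \<alpha> \<beta> 1 < \<beta>"
  shows "state_constraint lam h (perron \<alpha> \<beta>)"
  unfolding state_constraint_def
proof (intro allI impI)
  let ?W = "perron \<alpha> \<beta>"
  fix \<phi> assume \<phi>: "\<phi> C1_differentiable_on UNIV" "\<phi> 1 = ?W 1"
    and "\<exists>\<delta>>0. \<forall>r\<in>{1 - \<delta><..<1}. ?W r \<ge> \<phi> r"
  then obtain d where d: "d > 0" "\<And>r. r \<in> {1 - d<..<1} \<Longrightarrow> ?W r \<ge> \<phi> r"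
    by auto
  show "lam * \<phi> 1 + h 1 (deriv \<phi> 1) \<ge> 0"
  proof (rule ccontr)
    assume neg: "\<not> ?thesis"
    define \<delta> where "\<delta> = min d 1"
    have \<delta>: "\<delta> > 0" "\<delta> \<le> d" "\<delta> \<le> 1"
      using d(1) by (auto simp: \<delta>_def)
    obtain v where v: "arc_subsolution lam h v" "v 1 > ?W 1" "v 1 \<le> ?W 1 + (\<beta> - ?W 1)"
        "\<And>r. r \<in> {0..1} \<Longrightarrow> \<bar>r - 1\<bar> \<ge> \<delta> \<Longrightarrow> v r = ?W r"
    proof (rule arc_subsolution_bump[OF arc_subsolution_perron _ \<phi> \<delta>(1), of "\<beta> - ?W 1"])
      show "\<phi> r \<le> ?W r" if "r \<in> {0..1}" "\<bar>r - 1\<bar> < \<delta>" for r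
        using d(2)[of r] that \<delta> \<phi>(2) by (cases "r = 1") auto
    qed (use neg assms in auto)
    have "v 0 \<le> \<alpha>" "v 1 \<le> \<beta>"
      using v(3) v(4)[of 0] \<delta> perron_end_points by auto
    then have "v 1 \<le> ?W 1"
      using v(1) by (intro perron_upper) auto
    with v(2) show False by simp
  qed
qed

lemma maximal_subsolution_eq_perron:
  obtains \<beta> where "\<And>s. maximal_subsolution lam h \<alpha> s = perron \<alpha> \<beta> s" "perron \<alpha> \<beta> 1 < \<beta>"
proof -
  obtain M where M: "\<And>w s. arc_subsolution lam h w \<Longrightarrow> s \<in> {0..1} \<Longrightarrow> w s \<le> M"
    using subsolutions_bounded_above by blast
  have "w 1 \<le> M + 1" if "arc_subsolution lam h w" for w
    using M[OF that, of 1] by simp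
  then have "maximal_subsolution lam h \<alpha> s = perron \<alpha> (M + 1) s" for s
    unfolding maximal_subsolution_def perron_def by (intro arg_cong[where f = Sup]) blast
  moreover have "perron \<alpha> (M + 1) 1 \<le> M"
    by (rule perron_least) (use M in auto)
  ultimately show thesis
    by (intro that[of "M + 1"]) auto
qed

lemma maximal_subsolution:
  shows "arc_subsolution lam h (maximal_subsolution lam h \<alpha>)"
    and "arc_supersolution lam h (maximal_subsolution lam h \<alpha>)"
    and "state_constraint lam h (maximal_subsolution lam h \<alpha>)"
    and "maximal_subsolution lam h \<alpha> 0 \<le> \<alpha>"
    and "arc_subsolution lam h w \<Longrightarrow> w 0 \<le> \<alpha> \<Longrightarrow> s \<in> {0..1} \<Longrightarrow> w s \<le> maximal_subsolution lam h \<alpha> s"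
proof -
  obtain \<beta> where "\<And>s. maximal_subsolution lam h \<alpha> s = perron \<alpha> \<beta> s" and \<beta>: "perron \<alpha> \<beta> 1 < \<beta>"
    using maximal_subsolution_eq_perron by blast
  then have eq: "maximal_subsolution lam h \<alpha> = perron \<alpha> \<beta>"
    by blast
  show "arc_subsolution lam h (maximal_subsolution lam h \<alpha>)"
    "arc_supersolution lam h (maximal_subsolution lam h \<alpha>)"
    "state_constraint lam h (maximal_subsolution lam h \<alpha>)"
    "maximal_subsolution lam h \<alpha> 0 \<le> \<alpha>"
    unfolding eq using arc_subsolution_perron arc_supersolution_perron state_constraint_perron[OF \<beta>]
      perron_end_points by auto
  assume w: "arc_subsolution lam h w" "w 0 \<le> \<alpha>" "s \<in> {0..1}"
  obtain M where M: "\<And>w s. arc_subsolution lam h w \<Longrightarrow> s \<in> {0..1} \<Longrightarrow> w s \<le> M"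
    using subsolutions_bounded_above by blast
  have "bdd_above {w s | w. arc_subsolution lam h w \<and> w 0 \<le> \<alpha>}"
    using M w(3) by (intro bdd_aboveI[of _ M]) auto
  then show "w s \<le> maximal_subsolution lam h \<alpha> s"
    unfolding maximal_subsolution_def using w by (intro cSup_upper) auto
qed

text \<open>A supersolution subject to the state constraint at \<open>1\<close> dominates every subsolution starting
  below it, while a subsolution lies below the maximal one by definition.\<close>

lemma state_constraint_imp_maximal:
  assumes "arc_subsolution lam h w" "arc_supersolution lam h w" "state_constraint lam h w"
    and "s \<in> {0..1}"
  shows "w s = maximal_subsolution lam h (w 0) s"
proof (rule antisym)
  show "w s \<le> maximal_subsolution lam h (w 0) s"
    using assms by (intro maximal_subsolution) auto
  show "maximal_subsolution lam h (w 0) s \<le> w s"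
    by (rule comparison[OF _ assms(2) _ _ assms(4)])
      (use assms(3) maximal_subsolution in auto)
qed

text \<open>Lowering a subsolution by a positive constant gives a subsolution. So subsolutions that reach
  \<open>\<alpha>\<close> at \<open>0\<close>, respectively \<open>\<beta>\<close> at \<open>1\<close>, can be lowered to reach them exactly, and both
  Dirichlet conditions are attained by the largest admissible subsolution.\<close>

lemma perron_attains_end_points:
  assumes "arc_subsolution lam h v" "v 0 \<le> \<alpha>" "v 1 \<ge> \<beta>"
    and "arc_subsolution lam h w" "w 0 \<ge> \<alpha>" "w 1 \<le> \<beta>"
  shows "perron \<alpha> \<beta> 0 = \<alpha>" "perron \<alpha> \<beta> 1 = \<beta>"
proof -
  have "arc_subsolution lam h (\<lambda>s. w s - (w 0 - \<alpha>))" "arc_subsolution lam h (\<lambda>s. v s - (v 1 - \<beta>))"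
    using assms lam_pos by (auto intro!: arc_subsolution_shift)
  from perron_upper[OF this(1), of \<alpha> \<beta> 0] perron_upper[OF this(2), of \<alpha> \<beta> 1]
  show "perron \<alpha> \<beta> 0 = \<alpha>" "perron \<alpha> \<beta> 1 = \<beta>"
    using assms perron_end_points[of \<alpha> \<beta>] by auto
qed

lemma dirichlet_unique:
  assumes "arc_subsolution lam h v" "arc_supersolution lam h v"
    and "arc_subsolution lam h w" "arc_supersolution lam h w"
    and "v 0 = w 0" "v 1 = w 1" "s \<in> {0..1}"
  shows "v s = w s"
  using comparison[of v w s] comparison[of w v s] assms by auto

lemma dirichlet_solvable:
  assumes "\<beta> \<le> maximal_subsolution lam h \<alpha> 1"
    and "arc_subsolution lam h w" "w 0 \<ge> \<alpha>" "w 1 \<le> \<beta>"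
  obtains v where "arc_subsolution lam h v" "arc_supersolution lam h v" "v 0 = \<alpha>" "v 1 = \<beta>"
  using perron_attains_end_points[OF maximal_subsolution(1,4) assms]
    arc_subsolution_perron arc_supersolution_perron that by blast

end

section \<open>The geometry of a network\<close>

lemma inverse_arc_apply: "s \<in> {0..1} \<Longrightarrow> inverse_arc \<gamma> s = \<gamma> (1 - s)"
  by (simp add: inverse_arc_def reversepath_def)

lemma inverse_arc_involution:
  assumes "\<gamma> \<in> extensional {0..1}"
  shows "inverse_arc (inverse_arc \<gamma>) = \<gamma>"
proof (rule extensionalityI[OF _ assms])
  show "inverse_arc (inverse_arc \<gamma>) \<in> extensional {0..1}"
    by (simp add: inverse_arc_def)
qed (simp add: inverse_arc_apply)

lemma network_inverse_arc: "network A \<Longrightarrow> \<gamma> \<in> A \<Longrightarrow> inverse_arc \<gamma> \<in> A"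
  by (simp add: network_def)

lemma end_points_in_network_vertices:
  assumes "\<gamma> \<in> A"
  shows "\<gamma> 0 \<in> network_vertices A" "\<gamma> 1 \<in> network_vertices A"
  using assms by (auto simp: network_vertices_def)

lemma vertex_has_incoming_arc:
  assumes "network A" "x \<in> network_vertices A"
  shows "\<exists>\<gamma>\<in>A. \<gamma> 1 = x"
proof -
  obtain \<gamma> where \<gamma>: "\<gamma> \<in> A" "x = \<gamma> 0 \<or> x = \<gamma> 1"
    using assms(2) by (auto simp: network_vertices_def)
  then have "inverse_arc \<gamma> \<in> A" "inverse_arc \<gamma> 1 = \<gamma> 0"
    using assms(1) by (auto simp: network_inverse_arc inverse_arc_apply)
  with \<gamma> show ?thesis by metis
qed

text \<open>The open part of an arc meets no arc except itself and its inverse, and simple paths are injective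
  apart from the end points.\<close>

lemma network_parametrizations_agree:
  assumes A: "network A" and \<gamma>: "\<gamma> \<in> A" "\<gamma>' \<in> A"
    and s: "s \<in> {0..1}" "s' \<in> {0..1}" and eq: "\<gamma> s = \<gamma>' s'"
  shows "s \<in> {0, 1} \<and> s' \<in> {0, 1} \<or> \<gamma>' = \<gamma> \<and> s' = s \<or> \<gamma>' = inverse_arc \<gamma> \<and> s' = 1 - s"
proof -
  have inv: "inverse_arc (inverse_arc \<gamma>) = \<gamma>" "inverse_arc (inverse_arc \<gamma>') = \<gamma>'"
    using A \<gamma> by (auto simp: network_def intro!: inverse_arc_involution)
  have loop_free: "x = y \<or> x = 0 \<and> y = 1 \<or> x = 1 \<and> y = 0"
    if "x \<in> {0..1}" "y \<in> {0..1}" "\<gamma> x = \<gamma> y" for x y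
    using A \<gamma>(1) that by (auto simp: network_def simple_path_def loop_free_def)
  show ?thesis
  proof (cases "s \<in> {0, 1} \<and> s' \<in> {0, 1}")
    case False
    then consider "s \<in> {0<..<1}" | "s' \<in> {0<..<1}"
      using s by fastforce
    then have "\<gamma>' = \<gamma> \<or> \<gamma>' = inverse_arc \<gamma>"
    proof cases
      case 1
      then have "\<gamma> ` {0<..<1} \<inter> path_image \<gamma>' \<noteq> {}"
        unfolding path_image_def using eq s(2) by (metis disjoint_iff image_eqI)
      then have "\<gamma> = \<gamma>' \<or> \<gamma> = inverse_arc \<gamma>'"
        using A \<gamma> unfolding network_def by blast
      then show ?thesis
        using inv by auto
    next
      case 2
      then have "\<gamma>' ` {0<..<1} \<inter> path_image \<gamma> \<noteq> {}"
        unfolding path_image_def using eq s(1) by (metis disjoint_iff image_eqI)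
      then show ?thesis
        using A \<gamma> unfolding network_def by blast
    qed
    then show ?thesis
    proof
      assume "\<gamma>' = \<gamma>"
      with loop_free[OF s] eq False show ?thesis
        by auto
    next
      assume "\<gamma>' = inverse_arc \<gamma>"
      then have "\<gamma> s = \<gamma> (1 - s')"
        using eq s(2) by (simp add: inverse_arc_apply)
      with loop_free[of s "1 - s'"] s False \<open>\<gamma>' = inverse_arc \<gamma>\<close> show ?thesis
        by auto
    qed
  qed simp
qed

text \<open>Continuity descends along a continuous map of a compact set, since this map is closed.\<close>

lemma continuous_on_image_of_compact:
  fixes f :: "'a::topological_space \<Rightarrow> 'b::t2_space" and g :: "'b \<Rightarrow> 'c::topological_space"
  assumes "compact S" "continuous_on S f" "continuous_on S (g \<circ> f)"
  shows "continuous_on (f ` S) g"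
proof -
  have "\<exists>T. closed T \<and> T \<inter> f ` S = g -` B \<inter> f ` S" if B: "closed B" for B
  proof -
    obtain C where C: "closed C" "C \<inter> S = (g \<circ> f) -` B \<inter> S"
      using assms(3)[unfolded continuous_on_closed_invariant, rule_format, OF B] by metis
    have "compact (C \<inter> S)"
      using C(1) assms(1) by (rule closed_Int_compact)
    then have "closed (f ` (C \<inter> S))"
      by (intro compact_imp_closed compact_continuous_image continuous_on_subset[OF assms(2)]) auto
    moreover have "f ` (C \<inter> S) \<inter> f ` S = g -` B \<inter> f ` S"
      unfolding C(2) by auto
    ultimately show ?thesis by metis
  qed
  then show ?thesis
    unfolding continuous_on_closed_invariant by simp
qed

text \<open>Prescribed vertex values and compatibility with reversal are exactly what the ambiguity of the
  parametrization requires.\<close>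

lemma glue_arc_functions:
  fixes A :: "(real \<Rightarrow> real ^ 'n::finite) set"
  assumes A: "network A"
    and f_cont: "\<And>\<gamma>. \<gamma> \<in> A \<Longrightarrow> continuous_on {0..1} (f \<gamma>)"
    and f_ends: "\<And>\<gamma>. \<gamma> \<in> A \<Longrightarrow> f \<gamma> 0 = U (\<gamma> 0)" "\<And>\<gamma>. \<gamma> \<in> A \<Longrightarrow> f \<gamma> 1 = U (\<gamma> 1)"
    and f_inverse: "\<And>\<gamma> s. \<gamma> \<in> A \<Longrightarrow> s \<in> {0..1} \<Longrightarrow> f (inverse_arc \<gamma>) s = f \<gamma> (1 - s)"
  obtains u :: "real ^ 'n \<Rightarrow> real"
    where "u \<in> extensional (network_set A)" "continuous_on (network_set A) u"
      "\<And>\<gamma> s. \<gamma> \<in> A \<Longrightarrow> s \<in> {0..1} \<Longrightarrow> u (\<gamma> s) = f \<gamma> s"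
proof -
  have well_defined: "f \<gamma> s = f \<gamma>' s'"
    if "\<gamma> \<in> A" "\<gamma>' \<in> A" "s \<in> {0..1}" "s' \<in> {0..1}" "\<gamma> s = \<gamma>' s'" for \<gamma> \<gamma>' s s'
    using network_parametrizations_agree[OF A that]
  proof (elim disjE conjE)
    assume "s \<in> {0, 1}" "s' \<in> {0, 1}"
    then have "f \<gamma> s = U (\<gamma> s)" "f \<gamma>' s' = U (\<gamma>' s')"
      using f_ends that(1,2) by auto
    with that(5) show ?thesis by simp
  next
    assume "\<gamma>' = inverse_arc \<gamma>" "s' = 1 - s"
    then show ?thesis
      using f_inverse[of \<gamma> s'] that by simp
  qed simp
  define u where "u = restrict (\<lambda>x. SOME y. \<exists>\<gamma>\<in>A. \<exists>s\<in>{0..1}. \<gamma> s = x \<and> y = f \<gamma> s) (network_set A)"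
  have u_eq: "u (\<gamma> s) = f \<gamma> s" if \<gamma>: "\<gamma> \<in> A" "s \<in> {0..1}" for \<gamma> s
  proof -
    have "\<gamma> s \<in> network_set A"
      using that unfolding network_set_def path_image_def by blast
    moreover have "(SOME y. \<exists>\<gamma>'\<in>A. \<exists>s'\<in>{0..1}. \<gamma>' s' = \<gamma> s \<and> y = f \<gamma>' s') = f \<gamma> s"
      by (rule some_equality) (use that well_defined in blast)+
    ultimately show ?thesis by (simp add: u_def)
  qed
  have "continuous_on (path_image \<gamma>) u" if \<gamma>: "\<gamma> \<in> A" for \<gamma>
    unfolding path_image_def
  proof (rule continuous_on_image_of_compact)
    show "continuous_on {0..1} \<gamma>"
      using A \<gamma> by (auto simp: network_def simple_path_def path_def)
    show "continuous_on {0..1} (u \<circ> \<gamma>)"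
      using f_cont[OF \<gamma>] u_eq[OF \<gamma>] continuous_on_cong[of "{0..1}" "{0..1}" "u \<circ> \<gamma>" "f \<gamma>"] by simp
  qed simp
  moreover have "closed (path_image \<gamma>)" if "\<gamma> \<in> A" for \<gamma>
    using A that by (intro closed_path_image) (auto simp: network_def simple_path_def)
  ultimately have "continuous_on (network_set A) u"
    unfolding network_set_def using A
    by (intro continuous_on_closed_Union) (auto simp: network_def)
  then show thesis
    using that[of u] u_eq by (auto simp: u_def)
qed

section \<open>The discrete equation\<close>

lemma network_arc_hamiltonian:
  assumes "network_hamiltonian A H" "lam > 0" "\<gamma> \<in> A"
  shows "arc_hamiltonian lam (H \<gamma>)"
  using assms by unfold_locales (auto simp: network_hamiltonian_def)

lemma discrete_solution_iff_arcs:
  assumes "network A" "bij_betw \<Psi> E A"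
  shows "discrete_solution A E \<Psi> lam H U \<longleftrightarrow>
    (\<forall>x\<in>network_vertices A.
      U x = Min ((\<lambda>\<gamma>. maximal_subsolution lam (H \<gamma>) (U (\<gamma> 0)) 1) ` {\<gamma> \<in> A. \<gamma> 1 = x}))"
proof -
  have "{edge_rho \<Psi> lam H (U (edge_origin \<Psi> e)) e | e. e \<in> E \<and> edge_terminal E \<Psi> e = x} =
      (\<lambda>\<gamma>. maximal_subsolution lam (H \<gamma>) (U (\<gamma> 0)) 1) ` {\<gamma> \<in> A. \<gamma> 1 = x}" for x
  proof -
    have "A = \<Psi> ` E"
      using assms(2) by (simp add: bij_betw_def)
    then show ?thesis
      using edge_terminal_eq[OF assms]
      by (auto simp: edge_rho_def edge_origin_def)
  qed
  then show ?thesis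
    by (simp add: discrete_solution_def)
qed

text \<open>The minimum at a vertex is taken over a finite set, which is nonempty because the inverse of an arc
  leaving a vertex enters it.\<close>

lemma discrete_solution_iff:
  assumes "network A" "bij_betw \<Psi> E A"
  shows "discrete_solution A E \<Psi> lam H U \<longleftrightarrow>
    (\<forall>\<gamma>\<in>A. U (\<gamma> 1) \<le> maximal_subsolution lam (H \<gamma>) (U (\<gamma> 0)) 1) \<and>
    (\<forall>x\<in>network_vertices A. \<exists>\<gamma>\<in>A. \<gamma> 1 = x \<and> U x = maximal_subsolution lam (H \<gamma>) (U (\<gamma> 0)) 1)"
    (is "_ \<longleftrightarrow> ?le \<and> ?eq")
proof -
  let ?\<rho> = "\<lambda>\<gamma>. maximal_subsolution lam (H \<gamma>) (U (\<gamma> 0)) 1"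
  let ?S = "\<lambda>x. ?\<rho> ` {\<gamma> \<in> A. \<gamma> 1 = x}"
  have fin: "finite (?S x)" for x
    using assms(1) by (auto simp: network_def)
  have ne: "?S x \<noteq> {}" if "x \<in> network_vertices A" for x
    using vertex_has_incoming_arc[OF assms(1) that] by auto
  have "U x = Min (?S x) \<longleftrightarrow> U x \<in> ?S x \<and> (\<forall>y\<in>?S x. U x \<le> y)" if "x \<in> network_vertices A" for x
    using eq_Min_iff[OF fin ne[OF that]] .
  then have "discrete_solution A E \<Psi> lam H U \<longleftrightarrow>
      (\<forall>x\<in>network_vertices A. U x \<in> ?S x \<and> (\<forall>y\<in>?S x. U x \<le> y))"
    using discrete_solution_iff_arcs[OF assms] by simp
  also have "\<dots> \<longleftrightarrow> ?le \<and> ?eq"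
  proof (intro iffI conjI ballI)
    assume *: "\<forall>x\<in>network_vertices A. U x \<in> ?S x \<and> (\<forall>y\<in>?S x. U x \<le> y)"
    show "U (\<gamma> 1) \<le> ?\<rho> \<gamma>" if "\<gamma> \<in> A" for \<gamma>
      using * that end_points_in_network_vertices(2)[OF that] by blast
    show "\<exists>\<gamma>\<in>A. \<gamma> 1 = x \<and> U x = ?\<rho> \<gamma>" if "x \<in> network_vertices A" for x
      using * that by blast
  qed auto
  finally show ?thesis .
qed

lemma network_solutionD:
  assumes "network_solution A lam H u" "\<gamma> \<in> A"
  shows "arc_subsolution lam (H \<gamma>) (u \<circ> \<gamma>)" "arc_supersolution lam (H \<gamma>) (u \<circ> \<gamma>)"
  using assms by (auto simp: network_solution_def network_subsolution_def network_supersolution_def)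

lemma network_solution_imp_discrete_solution:
  assumes A: "network A" and H: "network_hamiltonian A H" and \<Psi>: "bij_betw \<Psi> E A"
    and lam: "lam > 0" and u: "network_solution A lam H u"
  shows "discrete_solution A E \<Psi> lam H (restrict u (network_vertices A))"
proof -
  note sub = network_solutionD(1)[OF u] and super = network_solutionD(2)[OF u]
  have "u (\<gamma> 1) \<le> maximal_subsolution lam (H \<gamma>) (u (\<gamma> 0)) 1" if \<gamma>: "\<gamma> \<in> A" for \<gamma>
    using arc_hamiltonian.maximal_subsolution(5)[OF network_arc_hamiltonian[OF H lam \<gamma>] sub[OF \<gamma>],
        of "u (\<gamma> 0)" 1] by simp
  moreover have "\<exists>\<gamma>\<in>A. \<gamma> 1 = x \<and> u x = maximal_subsolution lam (H \<gamma>) (u (\<gamma> 0)) 1"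
    if x: "x \<in> network_vertices A" for x
  proof -
    obtain \<gamma> where \<gamma>: "\<gamma> \<in> A" "\<gamma> 1 = x" "state_constraint lam (H \<gamma>) (u \<circ> \<gamma>)"
      using u x by (auto simp: network_solution_def network_supersolution_def)
    have "(u \<circ> \<gamma>) 1 = maximal_subsolution lam (H \<gamma>) ((u \<circ> \<gamma>) 0) 1"
      by (rule arc_hamiltonian.state_constraint_imp_maximal[OF network_arc_hamiltonian[OF H lam \<gamma>(1)]
            sub[OF \<gamma>(1)] super[OF \<gamma>(1)] \<gamma>(3)]) simp
    with \<gamma> show ?thesis by auto
  qed
  ultimately show ?thesis
    using end_points_in_network_vertices[of _ A] by (simp add: discrete_solution_iff[OF A \<Psi>])
qed

lemma network_solutions_eq:
  assumes H: "network_hamiltonian A H" and lam: "lam > 0"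
    and u: "network_solution A lam H u" and v: "network_solution A lam H v"
    and eq: "\<And>x. x \<in> network_vertices A \<Longrightarrow> u x = v x" and x: "x \<in> network_set A"
  shows "u x = v x"
proof -
  obtain \<gamma> s where \<gamma>: "\<gamma> \<in> A" and s: "s \<in> {0..1}" "x = \<gamma> s"
    using x by (auto simp: network_set_def path_image_def)
  have "(u \<circ> \<gamma>) s = (v \<circ> \<gamma>) s"
    by (rule arc_hamiltonian.dirichlet_unique[OF network_arc_hamiltonian[OF H lam \<gamma>]
          network_solutionD[OF u \<gamma>] network_solutionD[OF v \<gamma>]])
      (use s eq end_points_in_network_vertices[OF \<gamma>] in auto)
  with s show ?thesis by simp
qed

text \<open>The inequality of the discrete equation on an arc and on its inverse makes the Dirichlet problem
  on the arc solvable. On an arc that attains the minimum at its terminal point, the maximal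
  subsolution has the same values at both end points as the solution of the Dirichlet problem; by
  uniqueness they coincide, which yields the state constraint.\<close>

lemma discrete_solution_extends:
  fixes A :: "(real \<Rightarrow> real ^ 'n::finite) set"
  assumes A: "network A" and H: "network_hamiltonian A H" and \<Psi>: "bij_betw \<Psi> E A"
    and lam: "lam > 0" and U: "discrete_solution A E \<Psi> lam H U"
  obtains u where "u \<in> extensional (network_set A)" "network_solution A lam H u"
    "\<And>x. x \<in> network_vertices A \<Longrightarrow> u x = U x"
proof -
  note arc_ham = network_arc_hamiltonian[OF H lam]
  have H_inverse: "H \<gamma> s p = H (inverse_arc \<gamma>) (1 - s) (- p)"
    if "\<gamma> \<in> A" "s \<in> {0..1}" for \<gamma> s p
    using H that by (auto simp: network_hamiltonian_def)
  have le: "U (\<gamma> 1) \<le> maximal_subsolution lam (H \<gamma>) (U (\<gamma> 0)) 1" if "\<gamma> \<in> A" for \<gamma>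
    using U that by (simp add: discrete_solution_iff[OF A \<Psi>])
  have "\<exists>w. arc_subsolution lam (H \<gamma>) w \<and> arc_supersolution lam (H \<gamma>) w \<and>
      w 0 = U (\<gamma> 0) \<and> w 1 = U (\<gamma> 1)" if \<gamma>: "\<gamma> \<in> A" for \<gamma>
  proof -
    let ?\<gamma>' = "inverse_arc \<gamma>"
    let ?m = "maximal_subsolution lam (H ?\<gamma>') (U (?\<gamma>' 0))"
    have \<gamma>': "?\<gamma>' \<in> A"
      using A \<gamma> by (rule network_inverse_arc)
    have ends: "?\<gamma>' 0 = \<gamma> 1" "?\<gamma>' 1 = \<gamma> 0"
      by (auto simp: inverse_arc_apply)
    have m: "arc_subsolution lam (H \<gamma>) (\<lambda>s. ?m (1 - s))"
      by (rule arc_subsolution_reflect[OF arc_hamiltonian.maximal_subsolution(1)[OF arc_ham[OF \<gamma>']]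
            H_inverse[OF \<gamma>]])
    moreover have "U (\<gamma> 0) \<le> ?m (1 - 0)" "?m (1 - 1) \<le> U (\<gamma> 1)"
      using le[OF \<gamma>'] arc_hamiltonian.maximal_subsolution(4)[OF arc_ham[OF \<gamma>'], of "U (?\<gamma>' 0)"] ends
      by auto
    ultimately show ?thesis
      by (rule arc_hamiltonian.dirichlet_solvable[OF arc_ham[OF \<gamma>] le[OF \<gamma>]]) blast
  qed
  then obtain f where f: "\<And>\<gamma>. \<gamma> \<in> A \<Longrightarrow> arc_subsolution lam (H \<gamma>) (f \<gamma>)"
      "\<And>\<gamma>. \<gamma> \<in> A \<Longrightarrow> arc_supersolution lam (H \<gamma>) (f \<gamma>)"
      "\<And>\<gamma>. \<gamma> \<in> A \<Longrightarrow> f \<gamma> 0 = U (\<gamma> 0)" "\<And>\<gamma>. \<gamma> \<in> A \<Longrightarrow> f \<gamma> 1 = U (\<gamma> 1)"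
    by metis
  have f_inverse: "f (inverse_arc \<gamma>) s = f \<gamma> (1 - s)" if \<gamma>: "\<gamma> \<in> A" and s: "s \<in> {0..1}" for \<gamma> s
  proof -
    let ?\<gamma>' = "inverse_arc \<gamma>"
    have \<gamma>': "?\<gamma>' \<in> A"
      using A \<gamma> by (rule network_inverse_arc)
    have H': "H ?\<gamma>' s p = H \<gamma> (1 - s) (- p)" if "s \<in> {0..1}" for s p
      using H \<gamma> that by (auto simp: network_hamiltonian_def)
    show ?thesis
    proof (rule arc_hamiltonian.dirichlet_unique[OF arc_ham[OF \<gamma>'] f(1,2)[OF \<gamma>'] _ _ _ _ s])
      show "arc_subsolution lam (H ?\<gamma>') (\<lambda>s. f \<gamma> (1 - s))"
        by (rule arc_subsolution_reflect[OF f(1)[OF \<gamma>] H'])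
      show "arc_supersolution lam (H ?\<gamma>') (\<lambda>s. f \<gamma> (1 - s))"
        by (rule arc_supersolution_reflect[OF f(2)[OF \<gamma>] H'])
    qed (use f(3,4)[OF \<gamma>] f(3,4)[OF \<gamma>'] in \<open>auto simp: inverse_arc_apply\<close>)
  qed
  have f_cont: "continuous_on {0..1} (f \<gamma>)" if "\<gamma> \<in> A" for \<gamma>
    using f(1)[OF that] by (simp add: arc_subsolution_def)
  obtain u where u: "u \<in> extensional (network_set A)" "continuous_on (network_set A) u"
      "\<And>\<gamma> s. \<gamma> \<in> A \<Longrightarrow> s \<in> {0..1} \<Longrightarrow> u (\<gamma> s) = f \<gamma> s"
    using glue_arc_functions[OF A f_cont f(3,4) f_inverse] by blast
  have sub: "arc_subsolution lam (H \<gamma>) (u \<circ> \<gamma>)" if "\<gamma> \<in> A" for \<gamma>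
    using u(3)[OF that] by (intro arc_subsolution_cong[OF f(1)[OF that]]) auto
  have super: "arc_supersolution lam (H \<gamma>) (u \<circ> \<gamma>)" if "\<gamma> \<in> A" for \<gamma>
    using u(3)[OF that] by (intro arc_supersolution_cong[OF f(2)[OF that]]) auto
  have constraint: "\<exists>\<gamma>\<in>A. \<gamma> 1 = x \<and> state_constraint lam (H \<gamma>) (u \<circ> \<gamma>)"
    if x: "x \<in> network_vertices A" for x
  proof -
    obtain \<gamma> where \<gamma>: "\<gamma> \<in> A" "\<gamma> 1 = x" "U x = maximal_subsolution lam (H \<gamma>) (U (\<gamma> 0)) 1"
      using U x unfolding discrete_solution_iff[OF A \<Psi>] by blast
    let ?m = "maximal_subsolution lam (H \<gamma>) (U (\<gamma> 0))"
    note m = arc_hamiltonian.maximal_subsolution[OF arc_ham[OF \<gamma>(1)]]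
    have "f \<gamma> 0 \<le> ?m 0"
      using f(1,3)[OF \<gamma>(1)] by (intro m(5)) auto
    then have "?m 0 = f \<gamma> 0"
      using m(4)[of "U (\<gamma> 0)"] f(3)[OF \<gamma>(1)] by simp
    moreover have "?m 1 = f \<gamma> 1"
      using \<gamma> f(4) by simp
    ultimately have "?m s = f \<gamma> s" if "s \<in> {0..1}" for s
      using that by (rule arc_hamiltonian.dirichlet_unique[OF arc_ham[OF \<gamma>(1)] m(1,2) f(1,2)[OF \<gamma>(1)]])
    then have "state_constraint lam (H \<gamma>) (u \<circ> \<gamma>)"
      using u(3)[OF \<gamma>(1)] by (intro state_constraint_cong[OF m(3)[of "U (\<gamma> 0)"]]) auto
    with \<gamma> show ?thesis by blast
  qed
  have "network_solution A lam H u"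
    using u(2) sub super constraint
    by (simp add: network_solution_def network_subsolution_def network_supersolution_def)
  moreover have "u x = U x" if "x \<in> network_vertices A" for x
    using that u(3)[of _ 0] u(3)[of _ 1] f(3,4) by (auto simp: network_vertices_def)
  ultimately show thesis
    by (rule that[OF u(1)])
qed

theorem theorem4p2:
  fixes A :: "(real \<Rightarrow> real ^ 'n::finite) set"
    and H :: "(real \<Rightarrow> real ^ 'n) \<Rightarrow> real \<Rightarrow> real \<Rightarrow> real"
    and E :: "'e set"
    and \<Psi> :: "'e \<Rightarrow> real \<Rightarrow> real ^ 'n"
    and lam :: real
  assumes "network A"
    and "network_hamiltonian A H"
    and "bij_betw \<Psi> E A"
    and "lam > 0"
  shows "(\<forall>U. discrete_solution A E \<Psi> lam H U \<longrightarrow>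
            (\<exists>!u. u \<in> extensional (network_set A) \<and> network_solution A lam H u \<and>
              (\<forall>x\<in>network_vertices A. u x = U x))) \<and>
         (\<forall>u. network_solution A lam H u \<longrightarrow>
            discrete_solution A E \<Psi> lam H (restrict u (network_vertices A)))"
proof (intro conjI allI impI)
  fix U assume "discrete_solution A E \<Psi> lam H U"
  then obtain u where u: "u \<in> extensional (network_set A)" "network_solution A lam H u"
      "\<And>x. x \<in> network_vertices A \<Longrightarrow> u x = U x"
    using discrete_solution_extends[OF assms] by blast
  show "\<exists>!u. u \<in> extensional (network_set A) \<and> network_solution A lam H u \<and>
      (\<forall>x\<in>network_vertices A. u x = U x)"
  proof (rule ex1I[of _ u])
    fix v assume v: "v \<in> extensional (network_set A) \<and> network_solution A lam H v \<and>
      (\<forall>x\<in>network_vertices A. v x = U x)"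
    show "v = u"
      by (rule extensionalityI[OF _ u(1)])
        (use u v in \<open>auto intro: network_solutions_eq[OF assms(2,4)]\<close>)
  qed (use u in auto)
next
  fix u assume "network_solution A lam H u"
  then show "discrete_solution A E \<Psi> lam H (restrict u (network_vertices A))"
    by (rule network_solution_imp_discrete_solution[OF assms])
qed

end
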